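(* Let $G$ be a countable infinite residually finite discrete group and let $O$ be a topological $G$-odometer defined on a compact space $Y$. Then there exist a rank-one measure preserving continuous $G$-action $T$ on a locally compact Cantor space $X$ equipped with a $\sigma$-finite measure $\mu$, and a $G$-equivariant continuous mapping $\pi:X\to Y$, such that $O$ is a factor of $T$ (via $\pi$) and the measure $\mu\circ\pi^{-1}$ is equivalent (i.e. has the same ideal of subsets of zero measure) to the Haar measure on $Y$.
   Context: **Odometers.** Let $\Gamma_1\supsetneq\Gamma_2\supsetneq\cdots$ be finite-index subgroups of $G$ with $\bigcap_{n}\bigcap_{g\in G}g\Gamma_ng^{-1}=\{1_G\}$. Let $Y=\varprojlim G/\Gamma_n$ (with respect to the natural projections $G/\Gamma_{n+1}\to G/\Gamma_n$), a compact space on which $G$ acts by $O_g(g_n\Gamma_n)_{n}=(gg_n\Gamma_n)_{n}$. $(Y,O)$ is the topological $G$-odometer associated with $(\Gamma_n)_n$. The Haar measure on $Y$ is the unique $O$-invariant Borel probability. A locally compact Cantor space is a nonempty locally compact, second countable, totally disconnected Hausdorff space without isolated points. **Rank one.** Let $T=(T_g)_{g\in G}$ be a free nonsingular action of $G$ on a standard $\sigma$-finite non-atomic measure space $(X,\mathfrak B,\mu)$. A Rokhlin tower for $T$ is a pair $(B,F)$, with $B\in\mathfrak B$, $0<\mu(B)<\infty$, $F\subset G$ finite, $1_G\in F$, such that the sets $T_fB$, $f\in F$, are mutually disjoint and for each $f\in F$ the Radon–Nikodym derivative $\frac{d\mu\circ T_f}{d\mu}$ is constant on $B$. Let $X_{B,F}=\bigsqcup_{f\in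 F}T_fB$, let $\xi_{B,F}$ be the partition of $X_{B,F}$ into the sets $T_fB$, $f\in F$, and for $x\in T_fB$ let $O_{B,F}(x)=\{T_gx: g\in Ff^{-1}\}$. Given $\{1_G\}=F_0\subset F_1\subset F_2\subset\cdots$ finite subsets of $G$, $T$ is of rank one along $(F_n)_{n\ge 0}$ if there are sets $B_0\supset B_1\supset\cdots$ of positive measure such that each $(B_n,F_n)$ is a Rokhlin tower for $T$ and (i) $\xi_{B_n,F_n}\prec\xi_{B_{n+1},F_{n+1}}$ for each $n\ge0$ (each element of the former is a union of elements of the latter) and $\bigvee_{n}\xi_{B_n,F_n}$ is the partition of $X$ into singletons (mod 0); (ii) $\{T_gx: g\in G\}=\bigcup_{n\ge1}O_{B_n,F_n}(x)$ for a.e. $x\in X$. $T$ is of rank one if it is of rank one along some such sequence. *)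

theory Defs
  imports "HOL-Probability.Probability_Measure" "HOL-Algebra.Group_Action" "HOL-Algebra.Left_Coset"
begin

section \<open>Topology and measures\<close>

definition second_countable_space :: "'x topology \<Rightarrow> bool" where
  "second_countable_space X \<longleftrightarrow>
     (\<exists>\<B>. countable \<B> \<and> (\<forall>V\<in>\<B>. openin X V) \<and>
          (\<forall>U x. openin X U \<and> x \<in> U \<longrightarrow> (\<exists>V\<in>\<B>. x \<in> V \<and> V \<subseteq> U)))"

definition totally_disconnected_space :: "'x topology \<Rightarrow> bool" where
  "totally_disconnected_space X \<longleftrightarrow> (\<forall>S. connectedin X S \<longrightarrow> (\<exists>a. S \<subseteq> {a}))"

definition locally_compact_Cantor_space :: "'x topology \<Rightarrow> bool" where
  "locally_compact_Cantor_space X \<longleftrightarrow>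
     topspace X \<noteq> {} \<and> locally_compact_space X \<and> second_countable_space X \<and>
     totally_disconnected_space X \<and> Hausdorff_space X \<and>
     (\<forall>x\<in>topspace X. \<not> openin X {x})"

definition borel_of :: "'x topology \<Rightarrow> 'x measure" where
  "borel_of X = sigma (topspace X) {U. openin X U}"

text \<open>The \<open>\<sigma>\<close>-algebra is generated by some Polish topology on the underlying set.\<close>

definition standard_space :: "'x measure \<Rightarrow> bool" where
  "standard_space M \<longleftrightarrow>
     (\<exists>X. completely_metrizable_space X \<and> second_countable_space X \<and> sets M = sets (borel_of X))"

definition non_atomic :: "'x measure \<Rightarrow> bool" where
  "non_atomic M \<longleftrightarrow>
     \<not> (\<exists>A\<in>sets M. emeasure M A > 0 \<and>
           (\<forall>B\<in>sets M. B \<subseteq> A \<longrightarrow> emeasure M B = 0 \<or> emeasure M (A - B) = 0))"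

definition equivalent_measures :: "'x measure \<Rightarrow> 'x measure \<Rightarrow> bool" where
  "equivalent_measures M N \<longleftrightarrow> sets M = sets N \<and> null_sets M = null_sets N"


section \<open>Group actions\<close>

definition residually_finite :: "('a, 'b) monoid_scheme \<Rightarrow> bool" where
  "residually_finite G \<longleftrightarrow>
     (\<forall>g\<in>carrier G. g \<noteq> \<one>\<^bsub>G\<^esub> \<longrightarrow>
        (\<exists>N. N \<lhd> G \<and> finite (lcosets\<^bsub>G\<^esub> N) \<and> g \<notin> N))"

definition continuous_action ::
    "('a, 'b) monoid_scheme \<Rightarrow> 'x topology \<Rightarrow> ('a \<Rightarrow> 'x \<Rightarrow> 'x) \<Rightarrow> bool" where
  "continuous_action G X T \<longleftrightarrow>
     group_action G (topspace X) T \<and> (\<forall>g\<in>carrier G. continuous_map X X (T g))"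

definition nonsingular_action ::
    "('a, 'b) monoid_scheme \<Rightarrow> 'x measure \<Rightarrow> ('a \<Rightarrow> 'x \<Rightarrow> 'x) \<Rightarrow> bool" where
  "nonsingular_action G M T \<longleftrightarrow>
     group_action G (space M) T \<and>
     (\<forall>g\<in>carrier G. T g \<in> M \<rightarrow>\<^sub>M M \<and> equivalent_measures (distr M M (T g)) M)"

definition measure_preserving_action ::
    "('a, 'b) monoid_scheme \<Rightarrow> 'x measure \<Rightarrow> ('a \<Rightarrow> 'x \<Rightarrow> 'x) \<Rightarrow> bool" where
  "measure_preserving_action G M T \<longleftrightarrow>
     group_action G (space M) T \<and>
     (\<forall>g\<in>carrier G. T g \<in> M \<rightarrow>\<^sub>M M \<and> distr M M (T g) = M)"

definition free_action ::
    "('a, 'b) monoid_scheme \<Rightarrow> 'x measure \<Rightarrow> ('a \<Rightarrow> 'x \<Rightarrow> 'x) \<Rightarrow> bool" where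
  "free_action G M T \<longleftrightarrow> (AE x in M. stabilizer G T x = {\<one>\<^bsub>G\<^esub>})"

definition factor_map ::
    "('a, 'b) monoid_scheme \<Rightarrow> 'x measure \<Rightarrow> ('a \<Rightarrow> 'x \<Rightarrow> 'x) \<Rightarrow>
     'y measure \<Rightarrow> ('a \<Rightarrow> 'y \<Rightarrow> 'y) \<Rightarrow> ('x \<Rightarrow> 'y) \<Rightarrow> bool" where
  "factor_map G M T N S \<pi> \<longleftrightarrow>
     \<pi> \<in> M \<rightarrow>\<^sub>M N \<and>
     (\<forall>g\<in>carrier G. AE x in M. \<pi> (T g x) = S g (\<pi> x)) \<and>
     equivalent_measures (distr M N \<pi>) N"


section \<open>Rank one\<close>

text \<open>
  The image of a set \<open>A\<close> under \<open>T f\<close> is its preimage under \<open>T (inv f)\<close>, so the measure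
  \<open>A \<mapsto> \<mu> (T f ` A)\<close> is the push-forward of \<open>\<mu>\<close> under \<open>T (inv f)\<close>.
\<close>

definition Rokhlin_tower ::
    "('a, 'b) monoid_scheme \<Rightarrow> 'x measure \<Rightarrow> ('a \<Rightarrow> 'x \<Rightarrow> 'x) \<Rightarrow> 'x set \<Rightarrow> 'a set \<Rightarrow> bool" where
  "Rokhlin_tower G M T B F \<longleftrightarrow>
     B \<in> sets M \<and> 0 < emeasure M B \<and> emeasure M B < \<infinity> \<and>
     finite F \<and> F \<subseteq> carrier G \<and> \<one>\<^bsub>G\<^esub> \<in> F \<and>
     disjoint_family_on (\<lambda>f. T f ` B) F \<and>
     (\<forall>f\<in>F. \<exists>c. AE x in M. x \<in> B \<longrightarrow> RN_deriv M (distr M M (T (inv\<^bsub>G\<^esub> f))) x = c)"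

definition tower_partition :: "('a \<Rightarrow> 'x \<Rightarrow> 'x) \<Rightarrow> 'x set \<Rightarrow> 'a set \<Rightarrow> 'x set set" where
  "tower_partition T B F = (\<lambda>f. T f ` B) ` F"

text \<open>Empty for points outside the tower.\<close>

definition tower_orbit ::
    "('a, 'b) monoid_scheme \<Rightarrow> ('a \<Rightarrow> 'x \<Rightarrow> 'x) \<Rightarrow> 'x set \<Rightarrow> 'a set \<Rightarrow> 'x \<Rightarrow> 'x set" where
  "tower_orbit G T B F x =
     {T (k \<otimes>\<^bsub>G\<^esub> inv\<^bsub>G\<^esub> f) x | k f. k \<in> F \<and> f \<in> F \<and> x \<in> T f ` B}"

definition unions_refined_by :: "'x set set \<Rightarrow> 'x set set \<Rightarrow> bool" where
  "unions_refined_by \<xi> \<eta> \<longleftrightarrow> (\<forall>A\<in>\<xi>. \<exists>\<C>\<subseteq>\<eta>. A = \<Union>\<C>)"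

text \<open>
  The join of the partitions \<open>\<xi> n\<close> (each of a subset of the space) has as its element containing
  \<open>x\<close> the intersection of all members of all \<open>\<xi> n\<close> that contain \<open>x\<close>.
\<close>

definition joins_to_points :: "'x measure \<Rightarrow> (nat \<Rightarrow> 'x set set) \<Rightarrow> bool" where
  "joins_to_points M \<xi> \<longleftrightarrow>
     (\<exists>N\<in>null_sets M. \<forall>x\<in>space M - N.
        x \<in> (\<Union>n. \<Union>(\<xi> n)) \<and> \<Inter>{A \<in> (\<Union>n. \<xi> n). x \<in> A} - N = {x})"

definition rank_one_along ::
    "('a, 'b) monoid_scheme \<Rightarrow> 'x measure \<Rightarrow> ('a \<Rightarrow> 'x \<Rightarrow> 'x) \<Rightarrow> (nat \<Rightarrow> 'a set) \<Rightarrow> bool" where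
  "rank_one_along G M T F \<longleftrightarrow>
     (\<exists>B. (\<forall>n. B (Suc n) \<subseteq> B n) \<and>
          (\<forall>n. Rokhlin_tower G M T (B n) (F n)) \<and>
          (\<forall>n. unions_refined_by (tower_partition T (B n) (F n))
                                 (tower_partition T (B (Suc n)) (F (Suc n)))) \<and>
          joins_to_points M (\<lambda>n. tower_partition T (B n) (F n)) \<and>
          (AE x in M. orbit G T x = (\<Union>n\<in>{1..}. tower_orbit G T (B n) (F n) x)))"

definition rank_one_action ::
    "('a, 'b) monoid_scheme \<Rightarrow> 'x measure \<Rightarrow> ('a \<Rightarrow> 'x \<Rightarrow> 'x) \<Rightarrow> bool" where
  "rank_one_action G M T \<longleftrightarrow>
     standard_space M \<and> sigma_finite_measure M \<and> non_atomic M \<and>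
     nonsingular_action G M T \<and> free_action G M T \<and>
     (\<exists>F. F 0 = {\<one>\<^bsub>G\<^esub>} \<and>
          (\<forall>n. F n \<subseteq> F (Suc n) \<and> finite (F n) \<and> F n \<subseteq> carrier G) \<and>
          rank_one_along G M T F)"


section \<open>Odometers\<close>

definition odometer_sequence :: "('a, 'b) monoid_scheme \<Rightarrow> (nat \<Rightarrow> 'a set) \<Rightarrow> bool" where
  "odometer_sequence G \<Gamma> \<longleftrightarrow>
     (\<forall>n. subgroup (\<Gamma> n) G \<and> finite (lcosets\<^bsub>G\<^esub> (\<Gamma> n))) \<and>
     (\<forall>n. \<Gamma> (Suc n) \<subset> \<Gamma> n) \<and>
     (\<Inter>n. \<Inter>g\<in>carrier G. (\<lambda>h. g \<otimes>\<^bsub>G\<^esub> h \<otimes>\<^bsub>G\<^esub> inv\<^bsub>G\<^esub> g) ` \<Gamma> n) = {\<one>\<^bsub>G\<^esub>}"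

text \<open>
  The natural projection sends a coset \<open>g \<Gamma> (Suc n)\<close> to \<open>g \<Gamma> n\<close>, which is the product set of
  \<open>g \<Gamma> (Suc n)\<close> and \<open>\<Gamma> n\<close>.
\<close>

definition odometer_space ::
    "('a, 'b) monoid_scheme \<Rightarrow> (nat \<Rightarrow> 'a set) \<Rightarrow> (nat \<Rightarrow> 'a set) topology" where
  "odometer_space G \<Gamma> =
     subtopology (product_topology (\<lambda>n. discrete_topology (lcosets\<^bsub>G\<^esub> (\<Gamma> n))) UNIV)
       {y. \<forall>n. y n = y (Suc n) <#>\<^bsub>G\<^esub> \<Gamma> n}"

definition odometer ::
    "('a, 'b) monoid_scheme \<Rightarrow> (nat \<Rightarrow> 'a set) \<Rightarrow> 'a \<Rightarrow> (nat \<Rightarrow> 'a set) \<Rightarrow> (nat \<Rightarrow> 'a set)" where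
  "odometer G \<Gamma> g = (\<lambda>y\<in>topspace (odometer_space G \<Gamma>). \<lambda>n. g <#\<^bsub>G\<^esub> y n)"

definition odometer_Haar_measure ::
    "('a, 'b) monoid_scheme \<Rightarrow> (nat \<Rightarrow> 'a set) \<Rightarrow> (nat \<Rightarrow> 'a set) measure \<Rightarrow> bool" where
  "odometer_Haar_measure G \<Gamma> \<nu> \<longleftrightarrow>
     sets \<nu> = sets (borel_of (odometer_space G \<Gamma>)) \<and> prob_space \<nu> \<and>
     measure_preserving_action G \<nu> (odometer G \<Gamma>)"

end

theory Submission
  imports Defs
begin

text \<open>
  Choose finite sets \<open>C n\<close> of representatives of \<open>\<Gamma> n\<close> modulo \<open>\<Gamma> (Suc n)\<close>, spread out so that products
  \<open>f c\<close> with \<open>f \<in> F n\<close>, \<open>c \<in> C n\<close> determine their factors, and let \<open>F (Suc n)\<close> contain \<open>K F n C n\<close> for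
  a large finite \<open>K\<close>. Cutting the \<open>n\<close>-th tower, with levels indexed by \<open>F n\<close>, into copies indexed by
  \<open>C n\<close> and stacking them inside the next tower gives a locally compact space on which \<open>G\<close> acts by left
  multiplication of the level. The action is free and of rank one by construction. A point with
  levels \<open>f\<^sub>n\<close> is sent to the sequence of cosets \<open>f\<^sub>n \<Gamma> n\<close>. Since \<open>C n\<close> is an exact transversal, this map is
  a homeomorphism from each level of each tower onto a clopen subset of the odometer. The invariant
  measure is therefore the Haar measure pulled back along a local homeomorphism: it integrates the
  number of points in the fibres.
\<close>

text \<open>The obstacle is that \<open>G\<close> is an arbitrary group: the products
  \<open>F n C n\<close> need not be nearly invariant under translation, as Folner sets would be, so
  without enlargement an element \<open>g\<close> could push a point out of every tower. The factor
  \<open>K\<close> adds levels outside the previous tower, and since it runs through an enumeration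
  of \<open>G\<close>, every translate of every point is defined from some index on. The price is
  that \<open>F n\<close> need not be a transversal of the cosets of \<open>\<Gamma> n\<close>:
  several levels may lie over one coset, and fibres and total mass may be infinite. Hence the image
  measure is only equivalent to the Haar measure. Its density is the number of points in the fibre,
  which vanishes nowhere because the map is onto.\<close>

no_notation Multiset.subset_mset (infix "<#" 50)

section \<open>Borel sets, densities and atoms in general spaces\<close>

lemma space_borel_of: "space (borel_of X) = topspace X"
  by (simp add: borel_of_def openin_subset subset_Pow_Union space_measure_of_conv)

lemma sets_borel_of: "sets (borel_of X) = sigma_sets (topspace X) {U. openin X U}"
  unfolding borel_of_def by (rule sets_measure_of) (auto dest: openin_subset)

lemma openin_borel_of: "openin X U \<Longrightarrow> U \<in> sets (borel_of X)"
  by (simp add: sets_borel_of sigma_sets.Basic)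

lemma continuous_map_measurable:
  assumes "continuous_map X Y f"
  shows "f \<in> borel_of X \<rightarrow>\<^sub>M borel_of Y"
proof (rule measurable_sigma_sets[OF sets_borel_of])
  show "f \<in> space (borel_of X) \<rightarrow> topspace Y"
    using assms by (auto simp: space_borel_of continuous_map_def)
  fix U assume "U \<in> {U. openin Y U}"
  then have "openin X {x \<in> topspace X. f x \<in> U}"
    using assms by (auto intro: openin_continuous_map_preimage)
  then have "{x \<in> topspace X. f x \<in> U} \<in> sets (borel_of X)"
    by (rule openin_borel_of)
  moreover have "f -` U \<inter> space (borel_of X) = {x \<in> topspace X. f x \<in> U}"
    by (auto simp: space_borel_of)
  ultimately show "f -` U \<inter> space (borel_of X) \<in> sets (borel_of X)"
    by simp
qed (auto dest: openin_subset)

text \<open>The constant 1 is a density of \<open>M\<close> with respect to itself, and densities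
  are unique up to null sets. For a measure preserving action this is the derivative condition of a
  Rokhlin tower.\<close>

lemma (in sigma_finite_measure) AE_RN_deriv_self: "AE x in M. RN_deriv M M x = 1"
  using RN_deriv_unique_sigma_finite[OF _ density_1 sigma_finite_measure_axioms] by auto

text \<open>Some member of the cover meets an atom in positive mass and therefore carries all of its
  mass. So the mass of an atom is at most \<open>e\<close> for every \<open>e\<close>, hence
  zero.\<close>

lemma non_atomicI:
  assumes cover: "\<And>e::real. 0 < e \<Longrightarrow>
      \<exists>\<C>. countable \<C> \<and> \<C> \<subseteq> sets M \<and> space M \<subseteq> \<Union>\<C> \<and> (\<forall>B\<in>\<C>. emeasure M B \<le> ennreal e)"
  shows "non_atomic M"
  unfolding non_atomic_def
proof
  assume "\<exists>A\<in>sets M. emeasure M A > 0 \<and>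
           (\<forall>B\<in>sets M. B \<subseteq> A \<longrightarrow> emeasure M B = 0 \<or> emeasure M (A - B) = 0)"
  then obtain A where A: "A \<in> sets M" "emeasure M A > 0"
      "\<And>B. \<lbrakk>B \<in> sets M; B \<subseteq> A\<rbrakk> \<Longrightarrow> emeasure M B = 0 \<or> emeasure M (A - B) = 0"
    by blast
  have le: "emeasure M A \<le> ennreal e" if e: "0 < e" for e
  proof -
    obtain \<C> where \<C>: "countable \<C>" "\<C> \<subseteq> sets M" "space M \<subseteq> \<Union>\<C>" "\<forall>B\<in>\<C>. emeasure M B \<le> ennreal e"
      using cover[OF e] by blast
    have "\<exists>B\<in>\<C>. emeasure M (A \<inter> B) \<noteq> 0"
    proof (rule ccontr)
      assume "\<not> ?thesis"
      then have "(\<lambda>B. A \<inter> B) ` \<C> \<subseteq> null_sets M"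
        using A(1) \<C>(2) by (auto intro!: null_setsI)
      then have "(\<Union>B\<in>\<C>. A \<inter> B) \<in> null_sets M"
        using \<C>(1) by (intro null_sets_UN') auto
      moreover have "(\<Union>B\<in>\<C>. A \<inter> B) = A"
        using \<C>(3) sets.sets_into_space[OF A(1)] by blast
      ultimately show False
        using A(2) by auto
    qed
    then obtain B where B: "B \<in> \<C>" "emeasure M (A \<inter> B) \<noteq> 0"
      by blast
    then have AB: "A \<inter> B \<in> sets M" "emeasure M (A - A \<inter> B) = 0"
      using A(1) A(3)[of "A \<inter> B"] \<C>(2) by auto
    have "emeasure M A \<le> emeasure M (A \<inter> B) + emeasure M (A - A \<inter> B)"
      using emeasure_subadditive[of "A \<inter> B" M "A - A \<inter> B"] AB(1) A(1) 
      by (simp add: Un_absorb1)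
    also have "\<dots> = emeasure M (A \<inter> B)"
      using AB(2) by simp
    also have "\<dots> \<le> emeasure M B"
      using B(1) \<C>(2) by (intro emeasure_mono) auto
    also have "\<dots> \<le> ennreal e"
      using \<C>(4) B(1) by (rule bspec)
    finally show ?thesis .
  qed
  have "emeasure M A \<le> 0"
    by (rule ennreal_le_epsilon) (simp add: le)
  then show False
    using A(2) by simp
qed

section \<open>Cosets and the combinatorial data of the towers\<close>

lemma (in group) lcoset_rep:
  assumes "subgroup H G" "A \<in> lcosets H" "a \<in> A"
  shows "a \<in> carrier G" "A = a <# H" "b \<in> A \<longleftrightarrow> b \<in> carrier G \<and> inv a \<otimes> b \<in> H"
proof -
  obtain c where c: "c \<in> carrier G" "A = c <# H"
    using assms(2) by (auto simp: LCOSETS_def)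
  show a: "a \<in> carrier G"
    using assms(3) c subgroup.elemlcos_carrier[OF assms(1) is_group] by blast
  show A: "A = a <# H"
    using l_repr_independence[OF _ c(1) assms(1)] assms(3) c(2) by blast
  show "b \<in> A \<longleftrightarrow> b \<in> carrier G \<and> inv a \<otimes> b \<in> H"
    using A a subgroup.elemlcos_carrier[OF assms(1) is_group a]
      subgroup.lcos_module_imp[OF assms(1) is_group a]
      subgroup.lcos_module_rev[OF assms(1) is_group a] by blast
qed

text \<open>Each assumption has one task. \<open>C_exhausts\<close> and \<open>C_separated\<close>
  make \<open>C n\<close> an exact transversal, for surjectivity and injectivity of the map on a
  level. \<open>factor_unique\<close> keeps the stacked copies disjoint; equality of the left
  factors follows by cancellation. \<open>F_absorbs\<close> makes translation by \<open>g\<close>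
  possible at late levels. \<open>C_nontrivial\<close> excludes isolated points and shrinks the
  levels.\<close>

locale odometer_tower = group G for G :: "('a, 'b) monoid_scheme" (structure) +
  fixes \<Gamma> F C :: "nat \<Rightarrow> 'a set"
  assumes subgroup_\<Gamma>: "subgroup (\<Gamma> n) G"
    and \<Gamma>_Suc: "\<Gamma> (Suc n) \<subseteq> \<Gamma> n"
    and finite_F: "finite (F n)"
    and F_subset: "F n \<subseteq> carrier G"
    and F_0: "F 0 = {\<one>}"
    and C_subset: "C n \<subseteq> \<Gamma> n"
    and one_C: "\<one> \<in> C n"
    and C_nontrivial: "\<exists>c\<in>C n. c \<noteq> \<one>"
    and C_exhausts: "h \<in> \<Gamma> n \<Longrightarrow> \<exists>c\<in>C n. inv c \<otimes> h \<in> \<Gamma> (Suc n)"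
    and C_separated: "\<lbrakk>c \<in> C n; d \<in> C n; inv c \<otimes> d \<in> \<Gamma> (Suc n)\<rbrakk> \<Longrightarrow> c = d"
    and factor_unique: "\<lbrakk>f \<in> F n; h \<in> F n; c \<in> C n; d \<in> C n; f \<otimes> c = h \<otimes> d\<rbrakk> \<Longrightarrow> c = d"
    and F_C_closed: "\<lbrakk>f \<in> F n; c \<in> C n\<rbrakk> \<Longrightarrow> f \<otimes> c \<in> F (Suc n)"
    and F_absorbs: "g \<in> carrier G \<Longrightarrow> \<exists>N. \<forall>n\<ge>N. \<forall>f\<in>F n. \<forall>c\<in>C n. g \<otimes> (f \<otimes> c) \<in> F (Suc n)"
begin

lemma \<Gamma>_carrier: "h \<in> \<Gamma> n \<Longrightarrow> h \<in> carrier G"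
  using subgroup.subset[OF subgroup_\<Gamma>] by blast

lemma F_carrier: "f \<in> F n \<Longrightarrow> f \<in> carrier G"
  using F_subset by blast

lemma C_carrier: "c \<in> C n \<Longrightarrow> c \<in> carrier G"
  using C_subset \<Gamma>_carrier by blast

lemma factor_unique_left:
  assumes "f \<in> F n" "h \<in> F n" "c \<in> C n" "d \<in> C n" "f \<otimes> c = h \<otimes> d"
  shows "f = h"
  using factor_unique[OF assms] assms by (metis F_carrier C_carrier right_cancel)

lemma F_Suc: "F n \<subseteq> F (Suc n)"
  using F_C_closed[OF _ one_C] F_carrier by fastforce

lemma F_mono: "m \<le> n \<Longrightarrow> F m \<subseteq> F n"
  by (rule lift_Suc_mono_le[of F, OF F_Suc])

lemma one_F: "\<one> \<in> F n"
  using F_mono[of 0 n] F_0 by auto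

section \<open>The space\<close>

text \<open>
  A point is a sequence whose \<open>n\<close>-th entry is the singleton of its level in the \<open>n\<close>-th tower,
  or empty as long as the point lies outside that tower. So the space is an inverse limit of the
  finite sets \<open>F n\<close> with an added point at infinity, minus the all-infinity thread.
\<close>

definition entries :: "nat \<Rightarrow> 'a set set" where
  "entries n = insert {} ((\<lambda>f. {f}) ` F n)"

text \<open>The bonding map of the inverse system: \<open>{f c}\<close> goes to \<open>{f}\<close>,
  and a level outside \<open>F n C n\<close>, which the next tower adds to the previous one, goes to
  the point at infinity \<open>{}\<close>.\<close>

definition bond :: "nat \<Rightarrow> 'a set \<Rightarrow> 'a set" where
  "bond n A = {f \<in> F n. \<exists>c\<in>C n. f \<otimes> c \<in> A}"

definition thread :: "(nat \<Rightarrow> 'a set) \<Rightarrow> bool" where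
  "thread x \<longleftrightarrow> (\<forall>n. x n \<in> entries n \<and> x n = bond n (x (Suc n)))"

definition pts :: "(nat \<Rightarrow> 'a set) set" where
  "pts = {x. thread x \<and> (\<exists>n. x n \<noteq> {})}"

definition cyl :: "nat \<Rightarrow> 'a \<Rightarrow> (nat \<Rightarrow> 'a set) set" where
  "cyl n f = {x \<in> pts. x n = {f}}"

lemma bond_singleton:
  assumes "f \<in> F n" "c \<in> C n"
  shows "bond n {f \<otimes> c} = {f}"
  using assms factor_unique_left by (fastforce simp: bond_def)

lemma bond_entries:
  assumes "A \<in> entries (Suc n)"
  shows "bond n A \<in> entries n"
proof (cases "bond n A = {}")
  case False
  then obtain f c where fc: "f \<in> F n" "c \<in> C n" "f \<otimes> c \<in> A"
    by (auto simp: bond_def)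
  then have "A = {f \<otimes> c}"
    using assms by (auto simp: entries_def)
  then show ?thesis
    using bond_singleton fc by (auto simp: entries_def)
qed (simp add: entries_def)

lemma pts_bond: "x \<in> pts \<Longrightarrow> x n = bond n (x (Suc n))"
  unfolding pts_def thread_def by blast

lemma thread_entries: "thread x \<Longrightarrow> x n \<in> entries n"
  unfolding thread_def by blast

lemma pts_entries: "x \<in> pts \<Longrightarrow> x n \<in> entries n"
  by (simp add: pts_def thread_entries)

lemma pts_F: "\<lbrakk>x \<in> pts; x n = {f}\<rbrakk> \<Longrightarrow> f \<in> F n"
  using pts_entries[of x n] by (auto simp: entries_def)

lemma pts_cases: "\<lbrakk>x \<in> pts; x n \<noteq> {}\<rbrakk> \<Longrightarrow> \<exists>f\<in>F n. x n = {f}"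
  using pts_entries[of x n] by (auto simp: entries_def)

lemma pts_Suc:
  assumes "x \<in> pts" "x n = {f}"
  obtains c where "c \<in> C n" "x (Suc n) = {f \<otimes> c}"
proof -
  have "x n = bond n (x (Suc n))"
    using pts_bond[OF assms(1)] .
  then obtain c where c: "c \<in> C n" "f \<otimes> c \<in> x (Suc n)"
    using assms(2) by (auto simp: bond_def)
  then have "x (Suc n) = {f \<otimes> c}"
    using pts_cases[OF assms(1), of "Suc n"] by (metis empty_iff singletonD)
  then show thesis
    using c that by blast
qed

lemma pts_later:
  assumes "x \<in> pts" "x n = {f}" "n \<le> m"
  obtains h where "h \<in> F m" "x m = {h}"
proof -
  have "x m \<noteq> {}"
    using assms(3)
  proof (induction m rule: dec_induct)
    case (step m)
    then show ?case
      using pts_cases pts_Suc assms(1) by (metis insert_not_empty)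
  qed (use assms in simp)
  then show thesis
    using pts_cases assms(1) that by blast
qed

lemma pts_start:
  assumes "x \<in> pts"
  obtains n f where "f \<in> F n" "x n = {f}"
  using assms pts_cases unfolding pts_def by blast

lemma pts_reach:
  assumes "x \<in> pts"
  obtains m f where "n \<le> m" "f \<in> F m" "x m = {f}"
proof -
  obtain k h where h: "h \<in> F k" "x k = {h}"
    using pts_start assms by blast
  obtain f where "f \<in> F (max n k)" "x (max n k) = {f}"
    using pts_later[OF assms h(2), of "max n k"] by auto
  then show thesis
    using that[of "max n k" f] by simp
qed

lemma pts_eq_below:
  assumes "x \<in> pts" "z \<in> pts" "x m = z m" "k \<le> m"
  shows "x k = z k"
  using assms(4)
proof (induction rule: inc_induct)
  case (step k)
  then show ?case
    using pts_bond assms(1,2) by metis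
qed (use assms in simp)

lemma pts_eqI:
  assumes "x \<in> pts" "z \<in> pts" "eventually (\<lambda>k. x k = z k) sequentially"
  shows "x = z"
proof
  fix k
  obtain N where N: "\<forall>n\<ge>N. x n = z n"
    using assms(3) by (auto simp: eventually_sequentially)
  then show "x k = z k"
    using pts_eq_below[OF assms(1,2), of "max k N" k] by auto
qed

text \<open>A tail forces all earlier entries through the bonding maps. The induction on
  \<open>N\<close> overwrites entry \<open>N\<close> with the value forced by its successor and so
  lengthens the tail by one.\<close>

lemma thread_completion:
  assumes "\<forall>k\<ge>N. x k \<in> entries k \<and> x k = bond k (x (Suc k))"
  shows "\<exists>z. thread z \<and> (\<forall>k\<ge>N. z k = x k)"
  using assms
proof (induction N arbitrary: x)
  case 0
  then have "thread x"
    unfolding thread_def by blast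
  then show ?case
    by blast
next
  case (Suc N)
  define y where "y = x(N := bond N (x (Suc N)))"
  have "\<forall>k\<ge>N. y k \<in> entries k \<and> y k = bond k (y (Suc k))"
  proof (intro allI impI)
    fix k assume "N \<le> k"
    then consider "k = N" | "Suc N \<le> k"
      by linarith
    then show "y k \<in> entries k \<and> y k = bond k (y (Suc k))"
    proof cases
      case 1
      have "x (Suc N) \<in> entries (Suc N)"
        using Suc.prems by blast
      then show ?thesis
        using 1 bond_entries by (simp add: y_def)
    next
      case 2
      then have "y k = x k" "y (Suc k) = x (Suc k)"
        by (auto simp: y_def)
      then show ?thesis
        using Suc.prems[rule_format, OF 2] by metis
    qed
  qed
  then obtain z where "thread z" "\<forall>k\<ge>N. z k = y k"
    using Suc.IH by blast
  then show ?case
    by (intro exI[of _ z]) (auto simp: y_def)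
qed

text \<open>The source of all points built later: a sequence of levels in the group, each obtained
  from the last by a factor in \<open>C k\<close>, is the tail of a point.\<close>

lemma pts_completion:
  assumes "\<And>k. N \<le> k \<Longrightarrow> s k \<in> F k \<and> (\<exists>c\<in>C k. s (Suc k) = s k \<otimes> c)"
  obtains x where "x \<in> pts" "\<And>k. N \<le> k \<Longrightarrow> x k = {s k}"
proof -
  have "\<forall>k\<ge>N. {s k} \<in> entries k \<and> {s k} = bond k {s (Suc k)}"
    using assms bond_singleton by (fastforce simp: entries_def)
  from thread_completion[OF this] obtain x where "thread x" "\<And>k. N \<le> k \<Longrightarrow> x k = {s k}"
    by blast
  then show thesis
    using that[of x] unfolding pts_def by blast
qed

lemma cyl_nonempty:
  assumes "f \<in> F n"
  shows "cyl n f \<noteq> {}"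
proof -
  have "f \<in> F k \<and> (\<exists>c\<in>C k. f = f \<otimes> c)" if "n \<le> k" for k
    using assms F_mono[OF that] one_C F_carrier by force
  then obtain x where "x \<in> pts" "\<And>k. n \<le> k \<Longrightarrow> x k = {f}"
    using pts_completion[of n "\<lambda>_. f"] by metis
  then show ?thesis
    by (auto simp: cyl_def)
qed

lemma cyl_subset: "cyl n f \<subseteq> pts"
  by (auto simp: cyl_def)

lemma cyl_empty: "f \<notin> F n \<Longrightarrow> cyl n f = {}"
  using pts_F by (auto simp: cyl_def)

lemma cyl_refine:
  assumes "n \<le> m" "x \<in> cyl n f" "x \<in> cyl m h"
  shows "cyl m h \<subseteq> cyl n f"
  using assms pts_eq_below[of _ x m n] by (force simp: cyl_def)

lemma cyl_disjoint: "f \<noteq> h \<Longrightarrow> cyl n f \<inter> cyl n h = {}"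
  by (auto simp: cyl_def)

text \<open>Cylinders form a tree, because an entry determines all earlier ones.\<close>

lemma cyl_nested: "cyl n f \<inter> cyl m h \<in> {{}, cyl n f, cyl m h}"
proof (cases "cyl n f \<inter> cyl m h = {}")
  case False
  then obtain x where x: "x \<in> cyl n f" "x \<in> cyl m h"
    by blast
  then have "cyl m h \<subseteq> cyl n f \<or> cyl n f \<subseteq> cyl m h"
    using cyl_refine[of n m x f h] cyl_refine[of m n x h f] by linarith
  then show ?thesis
    by blast
qed simp

lemma cyl_Suc:
  assumes "f \<in> F n"
  shows "cyl n f = (\<Union>c\<in>C n. cyl (Suc n) (f \<otimes> c))"
proof (intro equalityI subsetI)
  fix x assume "x \<in> cyl n f"
  then have x: "x \<in> pts" "x n = {f}"
    by (auto simp: cyl_def)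
  obtain c where "c \<in> C n" "x (Suc n) = {f \<otimes> c}"
    using pts_Suc[OF x] .
  then show "x \<in> (\<Union>c\<in>C n. cyl (Suc n) (f \<otimes> c))"
    using x by (auto simp: cyl_def)
next
  fix x assume "x \<in> (\<Union>c\<in>C n. cyl (Suc n) (f \<otimes> c))"
  then obtain c where c: "c \<in> C n" "x \<in> pts" "x (Suc n) = {f \<otimes> c}"
    by (auto simp: cyl_def)
  then have "x n = bond n {f \<otimes> c}"
    using pts_bond by metis
  then show "x \<in> cyl n f"
    using c bond_singleton assms by (simp add: cyl_def)
qed

section \<open>The action\<close>

text \<open>Translating an early level may lead outside its tower, so only the tail is prescribed;
  it determines the point by \<open>pts_eqI\<close>. The restriction to \<open>pts\<close> makes
  \<open>act g\<close> extensional, as a member of the group of bijections must be.\<close>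

definition act :: "'a \<Rightarrow> (nat \<Rightarrow> 'a set) \<Rightarrow> nat \<Rightarrow> 'a set" where
  "act g = (\<lambda>x\<in>pts. THE z. z \<in> pts \<and> eventually (\<lambda>k. z k = g <# x k) sequentially)"

lemma act_eqI:
  assumes "x \<in> pts" "z \<in> pts" "eventually (\<lambda>k. z k = g <# x k) sequentially"
  shows "act g x = z"
proof -
  have "(THE z. z \<in> pts \<and> eventually (\<lambda>k. z k = g <# x k) sequentially) = z"
  proof (rule the_equality)
    fix w assume w: "w \<in> pts \<and> eventually (\<lambda>k. w k = g <# x k) sequentially"
    then have "eventually (\<lambda>k. w k = g <# x k) sequentially"
      by blast
    then have "eventually (\<lambda>k. w k = z k) sequentially"
      using assms(3) by eventually_elim simp
    then show "w = z"
      using w assms(2) pts_eqI by blast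
  qed (use assms in auto)
  then show ?thesis
    using assms(1) by (simp add: act_def)
qed

text \<open>Left translation commutes with the right factors from \<open>C k\<close>. Once the
  translated level lies in its tower, \<open>F_C_closed\<close> therefore keeps all later ones in
  theirs.\<close>

lemma act_level:
  assumes x: "x \<in> pts" "x m = {f}" and g: "g \<in> carrier G" "g \<otimes> f \<in> F m"
  shows "act g x \<in> pts" "\<And>k. m \<le> k \<Longrightarrow> act g x k = g <# x k" "act g x m = {g \<otimes> f}"
proof -
  define s where "s k = the_elem (x k)" for k
  have s: "x k = {s k}" "s k \<in> F k" if "m \<le> k" for k
  proof -
    obtain h where "h \<in> F k" "x k = {h}"
      using pts_later[OF x \<open>m \<le> k\<close>] .
    then show "x k = {s k}" "s k \<in> F k"
      by (auto simp: s_def)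
  qed
  have sc: "\<exists>c\<in>C k. s (Suc k) = s k \<otimes> c" if k: "m \<le> k" for k
  proof -
    obtain c where "c \<in> C k" "x (Suc k) = {s k \<otimes> c}"
      using pts_Suc[OF x(1) s(1)[OF k]] .
    then show ?thesis
      using s(1)[of "Suc k"] k by auto
  qed
  have gs: "g \<otimes> s k \<in> F k" if "m \<le> k" for k
    using that
  proof (induction k rule: dec_induct)
    case base
    then show ?case
      using g x by (simp add: s_def)
  next
    case (step k)
    then obtain c where c: "c \<in> C k" "s (Suc k) = s k \<otimes> c"
      using sc by auto
    then have "g \<otimes> s (Suc k) = g \<otimes> s k \<otimes> c"
      using g s(2)[of k] step F_carrier C_carrier by (simp add: m_assoc)
    then show ?case
      using F_C_closed[OF step.IH c(1)] by simp
  qed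
  have "g \<otimes> s k \<in> F k \<and> (\<exists>c\<in>C k. g \<otimes> s (Suc k) = g \<otimes> s k \<otimes> c)" if k: "m \<le> k" for k
    using sc[OF k] gs[OF k] g s(2)[OF k] F_carrier C_carrier by (metis m_assoc)
  then obtain z where z: "z \<in> pts" "\<And>k. m \<le> k \<Longrightarrow> z k = {g \<otimes> s k}"
    using pts_completion[of m "\<lambda>k. g \<otimes> s k"] by blast
  then have zg: "z k = g <# x k" if "m \<le> k" for k
    using that s by (simp add: l_coset_def)
  then have "eventually (\<lambda>k. z k = g <# x k) sequentially"
    unfolding eventually_sequentially by blast
  then have act: "act g x = z"
    by (rule act_eqI[OF x(1) z(1)])
  show "act g x \<in> pts" "\<And>k. m \<le> k \<Longrightarrow> act g x k = g <# x k"
    using z(1) zg by (simp_all only: act)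
  show "act g x m = {g \<otimes> f}"
    using z(2)[of m] x(2) by (simp add: act s_def)
qed

text \<open>\<open>F_absorbs\<close> speaks of products \<open>f c\<close> only. So the index found
  is one beyond a late index \<open>m\<close>, where the level of the point has become such a
  product.\<close>

lemma act_reach:
  assumes "x \<in> pts" "g \<in> carrier G"
  obtains m f where "n \<le> m" "f \<in> F m" "x m = {f}" "g \<otimes> f \<in> F m"
proof -
  obtain N where N: "\<forall>n\<ge>N. \<forall>f\<in>F n. \<forall>c\<in>C n. g \<otimes> (f \<otimes> c) \<in> F (Suc n)"
    using F_absorbs[OF assms(2)] ..
  obtain m f where m: "max n N \<le> m" "f \<in> F m" "x m = {f}"
    using pts_reach[OF assms(1), of "max n N"] .
  obtain c where c: "c \<in> C m" "x (Suc m) = {f \<otimes> c}"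
    using pts_Suc[OF assms(1) m(3)] .
  show thesis
  proof (rule that)
    show "n \<le> Suc m" "f \<otimes> c \<in> F (Suc m)" "x (Suc m) = {f \<otimes> c}" "g \<otimes> (f \<otimes> c) \<in> F (Suc m)"
      using m c N F_C_closed by auto
  qed
qed

lemma act_pts: "\<lbrakk>x \<in> pts; g \<in> carrier G\<rbrakk> \<Longrightarrow> act g x \<in> pts"
  by (rule act_reach[of x g]) (use act_level(1) in auto)

lemma act_eventually:
  assumes "x \<in> pts" "g \<in> carrier G"
  shows "eventually (\<lambda>k. act g x k = g <# x k) sequentially"
proof -
  obtain m f where "x m = {f}" "g \<otimes> f \<in> F m"
    by (rule act_reach[OF assms])
  then show ?thesis
    using act_level(2)[OF assms(1) _ assms(2)] unfolding eventually_sequentially by blast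
qed

lemma pts_carrier: "x \<in> pts \<Longrightarrow> x k \<subseteq> carrier G"
  using pts_cases[of x k] F_carrier by (cases "x k = {}") auto

lemma act_mult:
  assumes "x \<in> pts" "g \<in> carrier G" "h \<in> carrier G"
  shows "act (g \<otimes> h) x = act g (act h x)"
proof (rule act_eqI)
  show "eventually (\<lambda>k. act g (act h x) k = g \<otimes> h <# x k) sequentially"
    using act_eventually[OF assms(1,3)] act_eventually[OF act_pts[OF assms(1,3)] assms(2)]
  proof eventually_elim
    case (elim k)
    then show ?case
      using assms pts_carrier by (simp add: lcos_m_assoc)
  qed
qed (use assms act_pts in auto)

lemma act_one: "x \<in> pts \<Longrightarrow> act \<one> x = x"
  by (rule act_eqI) (auto simp: lcos_mult_one pts_carrier)

lemma act_inv:
  assumes "x \<in> pts" "g \<in> carrier G"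
  shows "act g (act (inv g) x) = x" "act (inv g) (act g x) = x"
  using assms act_mult[of x g "inv g"] act_mult[of x "inv g" g] act_one by auto

lemma act_bij: "g \<in> carrier G \<Longrightarrow> bij_betw (act g) pts pts"
  by (rule bij_betw_byWitness[where f' = "act (inv g)"]) (auto simp: act_inv act_pts)

lemma act_group_action: "group_action G pts act"
proof -
  have Bij: "act g \<in> Bij pts" if "g \<in> carrier G" for g
    using act_bij[OF that] by (auto simp: Bij_def act_def)
  have "act (g \<otimes> h) = compose pts (act g) (act h)" if "g \<in> carrier G" "h \<in> carrier G" for g h
    using act_mult that by (auto simp: compose_def act_def restrict_def fun_eq_iff)
  then have "act \<in> hom G (BijGroup pts)"
    using Bij by (auto simp: hom_def BijGroup_def)
  then show ?thesis
    by (auto simp: group_action_def group_hom_def group_hom_axioms_def group_BijGroup is_group)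
qed

lemma act_cyl:
  assumes "f \<in> F n" "g \<in> carrier G" "g \<otimes> f \<in> F n"
  shows "act g ` cyl n f = cyl n (g \<otimes> f)"
proof
  show "act g ` cyl n f \<subseteq> cyl n (g \<otimes> f)"
    using act_level(1,3)[OF _ _ assms(2,3)] by (auto simp: cyl_def)
  have "x \<in> act g ` cyl n f" if "x \<in> cyl n (g \<otimes> f)" for x
  proof -
    have f: "inv g \<otimes> (g \<otimes> f) = f"
      using assms F_carrier by (simp add: m_assoc[symmetric])
    have x: "x \<in> pts" "x n = {g \<otimes> f}"
      using that by (auto simp: cyl_def)
    have "act (inv g) x \<in> cyl n f"
      using act_level(1,3)[OF x, of "inv g"] f assms by (auto simp: cyl_def)
    then show ?thesis
      using act_inv(1)[OF x(1) assms(2)] by force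
  qed
  then show "cyl n (g \<otimes> f) \<subseteq> act g ` cyl n f"
    by blast
qed

text \<open>At a late level a fixed point would give \<open>g f = f\<close> in the group.\<close>

lemma act_free:
  assumes "x \<in> pts" "g \<in> carrier G" "act g x = x"
  shows "g = \<one>"
proof -
  obtain m f where m: "f \<in> F m" "x m = {f}" "g \<otimes> f \<in> F m"
    by (rule act_reach[OF assms(1,2)])
  then have "g \<otimes> f = f"
    using act_level(3)[OF assms(1) m(2) assms(2) m(3)] assms(3) by auto
  then show ?thesis
    using assms(2) m(1) F_carrier by (metis one_closed l_one right_cancel)
qed

section \<open>The topology\<close>

definition pts_top :: "(nat \<Rightarrow> 'a set) topology" where
  "pts_top = subtopology (product_topology (\<lambda>n. discrete_topology (entries n)) UNIV) pts"

lemma topspace_pts_top: "topspace pts_top = pts"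
  using pts_entries by (auto simp: pts_top_def)

lemma openin_cyl: "openin pts_top (cyl n f)"
proof (cases "f \<in> F n")
  case True
  have "continuous_map pts_top (discrete_topology (entries n)) (\<lambda>x. x n)"
    unfolding pts_top_def
    by (intro continuous_map_from_subtopology continuous_map_product_projection) simp
  moreover have "openin (discrete_topology (entries n)) {{f}}"
    using True by (auto simp: entries_def)
  ultimately have "openin pts_top {x \<in> topspace pts_top. x n \<in> {{f}}}"
    by (rule openin_continuous_map_preimage)
  then show ?thesis
    by (simp add: topspace_pts_top cyl_def)
qed (simp add: cyl_empty)

text \<open>A basic open set of the product restricts finitely many coordinates, and one later
  nonempty entry determines them all. The lower bound \<open>k\<close> leaves the choice of a finer
  cylinder.\<close>

lemma pts_top_base:
  assumes "openin pts_top U" "x \<in> U"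
  obtains n f where "k \<le> n" "f \<in> F n" "x \<in> cyl n f" "cyl n f \<subseteq> U"
proof -
  obtain V where V: "openin (product_topology (\<lambda>n. discrete_topology (entries n)) UNIV) V" "U = V \<inter> pts"
    using assms(1) by (auto simp: pts_top_def openin_subtopology)
  have x: "x \<in> V" "x \<in> pts"
    using assms(2) V by auto
  obtain W where W: "finite {i. W i \<noteq> entries i}" "x \<in> Pi\<^sub>E UNIV W" "Pi\<^sub>E UNIV W \<subseteq> V"
    using V(1)[unfolded openin_product_topology_alt, rule_format, OF x(1)] by auto
  obtain N where N: "\<forall>i\<in>{i. W i \<noteq> entries i}. i \<le> N"
    using W(1) finite_nat_set_iff_bounded_le by blast
  obtain n f where n: "max k N \<le> n" "f \<in> F n" "x n = {f}"
    using pts_reach[OF x(2)] .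
  have "cyl n f \<subseteq> U"
  proof
    fix z assume "z \<in> cyl n f"
    then have z: "z \<in> pts" "z n = {f}"
      by (auto simp: cyl_def)
    have "z i \<in> W i" for i
    proof (cases "W i = entries i")
      case True
      then show ?thesis
        using pts_entries[OF z(1)] by simp
    next
      case False
      then have "i \<le> n"
        using N n(1) by auto
      then have "z i = x i"
        using pts_eq_below[OF z(1) x(2), of n i] z(2) n(3) by simp
      then show ?thesis
        using W(2) by auto
    qed
    then show "z \<in> U"
      using W(3) z(1) V(2) by auto
  qed
  then show thesis
    using n x by (intro that[of n f]) (auto simp: cyl_def)
qed

lemma second_countable_pts_top: "second_countable_space pts_top"
  unfolding second_countable_space_def
proof (intro exI conjI allI impI ballI)
  let ?B = "(\<lambda>(n, f). cyl n f) ` (SIGMA n:UNIV. F n)"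
  show "countable ?B"
    by (intro countable_image countable_SIGMA) (auto simp: finite_F countable_finite)
  show "openin pts_top V" if "V \<in> ?B" for V
    using that openin_cyl by auto
  show "\<exists>V\<in>?B. x \<in> V \<and> V \<subseteq> U" if Ux: "openin pts_top U \<and> x \<in> U" for U x
  proof -
    obtain n f where "0 \<le> n" "f \<in> F n" "x \<in> cyl n f" "cyl n f \<subseteq> U"
      using pts_top_base[OF conjunct1[OF Ux] conjunct2[OF Ux]] .
    then show ?thesis
      by (intro bexI[of _ "cyl n f"]) auto
  qed
qed

text \<open>An intersection of equalisers of continuous maps into Hausdorff spaces.\<close>

lemma closedin_threads:
  "closedin (product_topology (\<lambda>n. discrete_topology (entries n)) UNIV) {x. thread x}"
proof -
  let ?P = "product_topology (\<lambda>n. discrete_topology (entries n)) UNIV"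
  have proj: "continuous_map ?P (discrete_topology (entries n)) (\<lambda>x. x n)" for n
    by (rule continuous_map_product_projection) simp
  have "closedin ?P {x \<in> topspace ?P. x n = bond n (x (Suc n))}" for n
  proof (rule closedin_continuous_maps_eq)
    show "Hausdorff_space (discrete_topology (entries n))"
      by simp
    have "continuous_map (discrete_topology (entries (Suc n))) (discrete_topology (entries n)) (bond n)"
      using bond_entries by auto
    from continuous_map_compose[OF proj this]
    show "continuous_map ?P (discrete_topology (entries n)) (\<lambda>x. bond n (x (Suc n)))"
      by (simp add: o_def)
  qed (rule proj)
  then have "closedin ?P (\<Inter>n. {x \<in> topspace ?P. x n = bond n (x (Suc n))})"
    by (intro closedin_INT) auto
  also have "(\<Inter>n. {x \<in> topspace ?P. x n = bond n (x (Suc n))}) = {x. thread x}"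
    by (simp only: thread_def topspace_product_topology PiE_UNIV_domain) auto
  finally show ?thesis .
qed

text \<open>The points form an open subset of the closed set of threads, and both passages preserve
  complete metrizability of the product.\<close>

lemma completely_metrizable_pts_top: "completely_metrizable_space pts_top"
proof -
  let ?P = "product_topology (\<lambda>n. discrete_topology (entries n)) UNIV"
  let ?T = "subtopology ?P {x. thread x}"
  have "completely_metrizable_space ?P"
    by (simp add: completely_metrizable_space_product_topology completely_metrizable_space_discrete_topology)
  then have T: "completely_metrizable_space ?T"
    using closedin_threads by (rule completely_metrizable_space_closedin)
  have "openin ?T {x \<in> topspace ?T. x n \<in> entries n - {{}}}" for n
  proof (rule openin_continuous_map_preimage)
    show "continuous_map ?T (discrete_topology (entries n)) (\<lambda>x. x n)"
      by (intro continuous_map_from_subtopology continuous_map_product_projection) simp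
  qed simp
  then have "openin ?T (\<Union>n. {x \<in> topspace ?T. x n \<in> entries n - {{}}})"
    by blast
  also have "(\<Union>n. {x \<in> topspace ?T. x n \<in> entries n - {{}}}) = pts"
    using thread_entries by (fastforce simp: pts_def)
  finally have "completely_metrizable_space (subtopology ?T pts)"
    using T completely_metrizable_space_openin by blast
  moreover have "{x. thread x} \<inter> pts = pts"
    by (auto simp: pts_def)
  ultimately show ?thesis
    by (simp add: pts_top_def subtopology_subtopology)
qed

text \<open>A nonempty entry at index \<open>n\<close> excludes the thread at infinity, so a
  cylinder is already closed in the compact product of finite sets.\<close>

lemma compactin_cyl: "compactin pts_top (cyl n f)"
proof (cases "f \<in> F n")
  case True
  let ?P = "product_topology (\<lambda>n. discrete_topology (entries n)) UNIV"
  have "closedin ?P {x \<in> topspace ?P. x n \<in> {{f}}}"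
  proof (rule closedin_continuous_map_preimage)
    show "continuous_map ?P (discrete_topology (entries n)) (\<lambda>x. x n)"
      by (rule continuous_map_product_projection) simp
    show "closedin (discrete_topology (entries n)) {{f}}"
      using True by (auto simp: entries_def)
  qed
  then have "closedin ?P ({x. thread x} \<inter> {x \<in> topspace ?P. x n \<in> {{f}}})"
    using closedin_threads by blast
  also have "{x. thread x} \<inter> {x \<in> topspace ?P. x n \<in> {{f}}} = cyl n f"
    using thread_entries by (fastforce simp: cyl_def pts_def)
  finally have "closedin ?P (cyl n f)" .
  moreover have "compact_space ?P"
    using finite_F by (simp add: compact_space_product_topology compact_space_discrete_topology entries_def)
  ultimately have "compactin ?P (cyl n f)"
    by (metis closedin_compact_space)
  then show ?thesis
    by (simp add: pts_top_def compactin_subtopology cyl_subset)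
qed (simp add: cyl_empty)

lemma pts_top_Cantor: "locally_compact_Cantor_space pts_top"
  unfolding locally_compact_Cantor_space_def
proof (intro conjI ballI notI)
  show "topspace pts_top = {} \<Longrightarrow> False"
    using cyl_nonempty[OF one_F[of 0]] cyl_subset by (auto simp: topspace_pts_top)
  show "locally_compact_space pts_top"
    unfolding locally_compact_space_def topspace_pts_top
  proof
    fix x assume "x \<in> pts"
    then obtain n f where "f \<in> F n" "x n = {f}"
      using pts_start by blast
    then have "x \<in> cyl n f"
      using \<open>x \<in> pts\<close> by (simp add: cyl_def)
    then show "\<exists>U K. openin pts_top U \<and> compactin pts_top K \<and> x \<in> U \<and> U \<subseteq> K"
      using openin_cyl compactin_cyl by blast
  qed
  show "second_countable_space pts_top"
    by (rule second_countable_pts_top)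
  show "totally_disconnected_space pts_top"
    unfolding totally_disconnected_space_def
  proof (intro allI impI)
    fix S assume S: "connectedin pts_top S"
    have "a = b" if ab: "a \<in> S" "b \<in> S" for a b
    proof
      fix n
      have "continuous_map pts_top (discrete_topology (entries n)) (\<lambda>x. x n)"
        unfolding pts_top_def
        by (intro continuous_map_from_subtopology continuous_map_product_projection) simp
      from connectedin_continuous_map_image[OF this S] obtain c where "(\<lambda>x. x n) ` S \<subseteq> {c}"
        by (auto simp: connectedin_discrete_topology)
      then show "a n = b n"
        using ab by blast
    qed
    then show "\<exists>a. S \<subseteq> {a}"
      by blast
  qed
  show "Hausdorff_space pts_top"
    unfolding pts_top_def by (simp add: Hausdorff_space_subtopology Hausdorff_space_product_topology)
  fix x assume x: "x \<in> topspace pts_top" "openin pts_top {x}"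
  obtain n f where n: "0 \<le> n" "f \<in> F n" "x \<in> cyl n f" "cyl n f \<subseteq> {x}"
    using pts_top_base[OF x(2) singletonI] .
  \<comment> \<open>A second element of \<open>C n\<close> puts two disjoint nonempty cylinders into
    \<open>cyl n f\<close>, which contradicts isolation.\<close>
  obtain c where c: "c \<in> C n" "c \<noteq> \<one>"
    using C_nontrivial by blast
  have "cyl (Suc n) (f \<otimes> c) \<union> cyl (Suc n) (f \<otimes> \<one>) \<subseteq> {x}"
    using n(4) cyl_Suc[OF n(2)] c(1) one_C by blast
  moreover have "f \<otimes> c \<noteq> f \<otimes> \<one>"
    using factor_unique[OF n(2) n(2) c(1) one_C] c(2) by blast
  ultimately show False
    using cyl_disjoint[of "f \<otimes> c" "f \<otimes> \<one>" "Suc n"] cyl_nonempty F_C_closed n(2) c(1) one_C by blast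
qed

lemma act_continuous:
  assumes "g \<in> carrier G"
  shows "continuous_map pts_top pts_top (act g)"
  unfolding continuous_map_def topspace_pts_top
proof (intro conjI allI impI)
  show "act g \<in> pts \<rightarrow> pts"
    using act_pts assms by blast
  fix U assume U: "openin pts_top U"
  show "openin pts_top {x \<in> pts. act g x \<in> U}"
  proof (subst openin_subopen, intro ballI)
    fix x assume x: "x \<in> {x \<in> pts. act g x \<in> U}"
    then have xU: "x \<in> pts" "act g x \<in> U"
      by auto
    obtain n h where "0 \<le> n" "h \<in> F n" and n: "act g x \<in> cyl n h" "cyl n h \<subseteq> U"
      using pts_top_base[OF U xU(2)] .
    obtain m f where m: "n \<le> m" "f \<in> F m" "x m = {f}" "g \<otimes> f \<in> F m"
      using act_reach[OF xU(1) assms] .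
    have xm: "x \<in> cyl m f"
      using x m by (simp add: cyl_def)
    have im: "act g ` cyl m f = cyl m (g \<otimes> f)"
      using act_cyl m assms by blast
    then have "act g x \<in> cyl m (g \<otimes> f)"
      using xm by blast
    then have "cyl m (g \<otimes> f) \<subseteq> U"
      using cyl_refine[OF m(1) n(1)] n(2) by blast
    then have "cyl m f \<subseteq> {x \<in> pts. act g x \<in> U}"
      using im cyl_subset by blast
    then show "\<exists>T. openin pts_top T \<and> x \<in> T \<and> T \<subseteq> {x \<in> pts. act g x \<in> U}"
      using xm openin_cyl by blast
  qed
qed

text \<open>There are countably many nonempty cylinders and they form a base. Cylinders as
  generators are what the induction over Borel sets in \<open>proj_image_sets\<close> needs.\<close>

lemma sets_borel_pts_top:
  "sets (borel_of pts_top) = sigma_sets pts {cyl n f | n f. True}"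
proof -
  have "{U. openin pts_top U} \<subseteq> sigma_sets pts {cyl n f | n f. True}"
  proof
    fix U assume "U \<in> {U. openin pts_top U}"
    then have U: "openin pts_top U"
      by simp
    let ?I = "{(n, f). f \<in> F n \<and> cyl n f \<subseteq> U}"
    have "?I \<subseteq> (SIGMA n:UNIV. F n)"
      by auto
    then have "countable ?I"
      by (rule countable_subset) (intro countable_SIGMA, auto simp: finite_F countable_finite)
    then have "(\<Union>(n, f)\<in>?I. cyl n f) \<in> sigma_sets pts {cyl n f | n f. True}"
      using cyl_subset by (intro sigma_sets_UNION countable_image) (auto intro!: sigma_sets.Basic)
    also have "(\<Union>(n, f)\<in>?I. cyl n f) = U"
    proof (intro equalityI subsetI)
      fix x assume "x \<in> U"
      obtain n f where "0 \<le> n" "f \<in> F n" "x \<in> cyl n f" "cyl n f \<subseteq> U"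
        using pts_top_base[OF U \<open>x \<in> U\<close>] .
      then show "x \<in> (\<Union>(n, f)\<in>?I. cyl n f)"
        by blast
    qed auto
    finally show "U \<in> sigma_sets pts {cyl n f | n f. True}" .
  qed
  then have "sigma_sets pts {U. openin pts_top U} = sigma_sets pts {cyl n f | n f. True}"
    using openin_cyl by (intro sigma_sets_eqI) (auto intro: sigma_sets.Basic)
  moreover have "{U. openin pts_top U} \<subseteq> Pow pts"
    using openin_subset topspace_pts_top by auto
  ultimately show ?thesis
    by (simp add: borel_of_def topspace_pts_top)
qed

section \<open>The map to the odometer\<close>

lemma \<Gamma>_mono: "m \<le> n \<Longrightarrow> \<Gamma> n \<subseteq> \<Gamma> m"
  by (rule lift_Suc_antimono_le[of \<Gamma>, OF \<Gamma>_Suc])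

abbreviation odo :: "(nat \<Rightarrow> 'a set) set" where
  "odo \<equiv> topspace (odometer_space G \<Gamma>)"

lemma odo_iff: "y \<in> odo \<longleftrightarrow> (\<forall>n. y n \<in> lcosets (\<Gamma> n) \<and> y n = y (Suc n) <#> \<Gamma> n)"
  by (auto simp: odometer_space_def PiE_UNIV_domain)

lemmas lcoset_\<Gamma> = lcoset_rep[OF subgroup_\<Gamma>]

lemma lcoset_in: "a \<in> carrier G \<Longrightarrow> a <# \<Gamma> n \<in> lcosets (\<Gamma> n)"
  by (auto simp: LCOSETS_def)

lemma lcoset_eq:
  assumes "a \<in> carrier G" "b \<in> carrier G" "inv a \<otimes> b \<in> \<Gamma> n"
  shows "a <# \<Gamma> n = b <# \<Gamma> n"
  using subgroup.lcos_module_rev[OF subgroup_\<Gamma> is_group assms] assms(1) subgroup_\<Gamma>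
  by (rule l_repr_independence)

lemma lcoset_project:
  assumes "a \<in> carrier G"
  shows "(a <# \<Gamma> (Suc n)) <#> \<Gamma> n = a <# \<Gamma> n"
proof -
  have "\<Gamma> (Suc n) <#> \<Gamma> n = \<Gamma> n"
  proof
    show "\<Gamma> (Suc n) <#> \<Gamma> n \<subseteq> \<Gamma> n"
      using \<Gamma>_Suc subgroup.m_closed[OF subgroup_\<Gamma>] by (fastforce simp: set_mult_def)
    have "\<one> \<otimes> h \<in> \<Gamma> (Suc n) <#> \<Gamma> n" if "h \<in> \<Gamma> n" for h
      using that subgroup.one_closed[OF subgroup_\<Gamma>] unfolding set_mult_def by blast
    then show "\<Gamma> n \<subseteq> \<Gamma> (Suc n) <#> \<Gamma> n"
      using \<Gamma>_carrier by fastforce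
  qed
  then show ?thesis
    using assms subgroup.subset[OF subgroup_\<Gamma>] by (simp add: l_coset_eq_set_mult set_mult_assoc)
qed

lemma odo_antimono: "y \<in> odo \<Longrightarrow> y (Suc n) \<subseteq> y n"
proof
  fix h assume y: "y \<in> odo" and h: "h \<in> y (Suc n)"
  have "h \<in> carrier G"
    using y h lcoset_\<Gamma>(1) by (metis odo_iff)
  moreover have "h \<otimes> \<one> \<in> y (Suc n) <#> \<Gamma> n"
    using h subgroup.one_closed[OF subgroup_\<Gamma>] unfolding set_mult_def by blast
  moreover have "y n = y (Suc n) <#> \<Gamma> n"
    using y unfolding odo_iff by blast
  ultimately show "h \<in> y n"
    by simp
qed

lemma odo_lcoset: "y \<in> odo \<Longrightarrow> y n \<in> lcosets (\<Gamma> n)"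
  unfolding odo_iff by blast

lemma odo_nonempty:
  assumes "y \<in> odo"
  obtains h where "h \<in> carrier G" "h \<in> y n"
proof -
  obtain a where "a \<in> carrier G" "y n = a <# \<Gamma> n"
    using odo_lcoset[OF assms, of n] by (auto simp: LCOSETS_def)
  then show thesis
    using lcos_self[OF _ subgroup_\<Gamma>] that by blast
qed

lemma odo_translate:
  assumes "y \<in> odo" "g \<in> carrier G"
  shows "(\<lambda>n. g <# y n) \<in> odo"
  unfolding odo_iff
proof
  fix n
  obtain h where h: "h \<in> carrier G" "h \<in> y (Suc n)"
    using odo_nonempty[OF assms(1)] .
  then have "y n = h <# \<Gamma> n" "y (Suc n) = h <# \<Gamma> (Suc n)"
    using lcoset_\<Gamma>(2) odo_lcoset odo_antimono assms(1) by blast+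
  then have "g <# y n = (g \<otimes> h) <# \<Gamma> n" "g <# y (Suc n) = (g \<otimes> h) <# \<Gamma> (Suc n)"
    using assms(2) h subgroup.subset[OF subgroup_\<Gamma>] by (simp_all add: lcos_m_assoc)
  then show "g <# y n \<in> lcosets (\<Gamma> n) \<and> g <# y n = g <# y (Suc n) <#> \<Gamma> n"
    using lcoset_in lcoset_project assms(2) h by simp
qed

text \<open>All nonempty entries from \<open>k\<close> on give the same coset of
  \<open>\<Gamma> k\<close> and empty ones contribute nothing, so the union names this coset without
  choosing an index.\<close>

definition proj :: "(nat \<Rightarrow> 'a set) \<Rightarrow> nat \<Rightarrow> 'a set" where
  "proj x k = (\<Union>m\<in>{k..}. x m <#> \<Gamma> k)"

text \<open>Each step from index \<open>j\<close> on multiplies on the right by an element of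
  \<open>C j\<close>, which lies in \<open>\<Gamma> j\<close> and so in
  \<open>\<Gamma> i\<close>.\<close>

lemma pts_drift:
  assumes "x \<in> pts" "x i = {f}" "i \<le> j" "x j = {h}"
  shows "inv f \<otimes> h \<in> \<Gamma> i"
  using assms(3,4)
proof (induction j arbitrary: h rule: dec_induct)
  case base
  have "f \<in> carrier G"
    using pts_F[OF assms(1,2)] F_carrier by blast
  moreover have "h = f"
    using assms(2) base by simp
  ultimately show ?case
    using subgroup.one_closed[OF subgroup_\<Gamma>] by simp
next
  case (step j)
  obtain k where k: "k \<in> F j" "x j = {k}"
    using pts_later[OF assms(1,2) step.hyps(1)] .
  obtain c where c: "c \<in> C j" "x (Suc j) = {k \<otimes> c}"
    using pts_Suc[OF assms(1) k(2)] .
  have f: "f \<in> carrier G"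
    using assms(1,2) pts_F F_carrier by blast
  have "inv f \<otimes> h = (inv f \<otimes> k) \<otimes> c"
    using c step.prems f k(1) F_carrier C_carrier by (simp add: m_assoc)
  moreover have "c \<in> \<Gamma> i"
    using c(1) C_subset \<Gamma>_mono[OF step.hyps(1)] by blast
  ultimately show ?case
    using step.IH[OF k(2)] subgroup.m_closed[OF subgroup_\<Gamma>] by simp
qed

lemma proj_level:
  assumes "x \<in> pts" "x m = {f}" "k \<le> m"
  shows "proj x k = f <# \<Gamma> k"
proof -
  have f: "f \<in> carrier G"
    using assms pts_F F_carrier by blast
  have "x i <#> \<Gamma> k \<subseteq> f <# \<Gamma> k" if "k \<le> i" for i
  proof (cases "x i = {}")
    case False
    then obtain h where h: "h \<in> F i" "x i = {h}"
      using pts_cases assms(1) by blast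
    have "inv f \<otimes> h \<in> \<Gamma> k"
    proof (cases "m \<le> i")
      case True
      then show ?thesis
        using pts_drift[OF assms(1,2) True h(2)] \<Gamma>_mono[OF assms(3)] by blast
    next
      case False
      then have "inv h \<otimes> f \<in> \<Gamma> i"
        using pts_drift[OF assms(1) h(2) _ assms(2)] by simp
      then have "inv (inv h \<otimes> f) \<in> \<Gamma> k"
        using \<Gamma>_mono[OF that] subgroup.m_inv_closed[OF subgroup_\<Gamma>] by blast
      then show ?thesis
        using f h(1) F_carrier by (simp add: inv_mult_group)
    qed
    then show ?thesis
      using lcoset_eq[OF f, of h k] h F_carrier by (simp add: l_coset_eq_set_mult)
  qed (simp add: set_mult_def)
  moreover have "f <# \<Gamma> k = x m <#> \<Gamma> k"
    using assms(2) by (simp add: l_coset_eq_set_mult)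
  ultimately show ?thesis
    using assms(3) unfolding proj_def by blast
qed

lemma proj_mem:
  assumes "x \<in> pts" "x m = {f}"
  shows "f \<in> proj x m"
  using proj_level[OF assms order_refl] lcos_self[OF F_carrier[OF pts_F[OF assms]] subgroup_\<Gamma>] by simp

lemma proj_odo:
  assumes "x \<in> pts"
  shows "proj x \<in> odo"
  unfolding odo_iff
proof
  fix n
  obtain m f where m: "Suc n \<le> m" "f \<in> F m" "x m = {f}"
    using pts_reach[OF assms] .
  then have "proj x n = f <# \<Gamma> n" "proj x (Suc n) = f <# \<Gamma> (Suc n)"
    using proj_level[OF assms m(3)] by auto
  then show "proj x n \<in> lcosets (\<Gamma> n) \<and> proj x n = proj x (Suc n) <#> \<Gamma> n"
    using lcoset_in lcoset_project F_carrier[OF m(2)] by simp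
qed

lemma proj_act:
  assumes "x \<in> pts" "g \<in> carrier G"
  shows "proj (act g x) = odometer G \<Gamma> g (proj x)"
proof
  fix k
  obtain m f where m: "k \<le> m" "f \<in> F m" "x m = {f}" "g \<otimes> f \<in> F m"
    using act_reach[OF assms] .
  have "proj (act g x) k = (g \<otimes> f) <# \<Gamma> k"
    using proj_level[OF act_pts[OF assms] act_level(3)[OF assms(1) m(3) assms(2) m(4)] m(1)] .
  also have "\<dots> = g <# proj x k"
    using proj_level[OF assms(1) m(3) m(1)] lcos_m_assoc[OF subgroup.subset[OF subgroup_\<Gamma>] assms(2)]
      F_carrier[OF m(2)] by simp
  finally show "proj (act g x) k = odometer G \<Gamma> g (proj x) k"
    using proj_odo[OF assms(1)] by (simp add: odometer_def)
qed

lemma proj_continuous: "continuous_map pts_top (odometer_space G \<Gamma>) proj"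
proof -
  have "continuous_map pts_top (discrete_topology (lcosets (\<Gamma> k))) (\<lambda>x. proj x k)" for k
    unfolding continuous_map_def topspace_pts_top
  proof (intro conjI allI impI)
    show "(\<lambda>x. proj x k) \<in> pts \<rightarrow> topspace (discrete_topology (lcosets (\<Gamma> k)))"
      using proj_odo odo_lcoset by auto
    fix U
    show "openin pts_top {x \<in> pts. proj x k \<in> U}"
    proof (subst openin_subopen, intro ballI)
      fix x assume "x \<in> {x \<in> pts. proj x k \<in> U}"
      then have x: "x \<in> pts" "proj x k \<in> U"
        by auto
      obtain m f where m: "k \<le> m" "f \<in> F m" "x m = {f}"
        using pts_reach[OF x(1)] .
      have "cyl m f \<subseteq> {x \<in> pts. proj x k \<in> U}"
        using proj_level[OF _ _ m(1)] m(3) x by (auto simp: cyl_def)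
      then show "\<exists>T. openin pts_top T \<and> x \<in> T \<and> T \<subseteq> {x \<in> pts. proj x k \<in> U}"
        using openin_cyl x(1) m(3) by (intro exI[of _ "cyl m f"]) (auto simp: cyl_def)
    qed
  qed
  then have "continuous_map pts_top (product_topology (\<lambda>n. discrete_topology (lcosets (\<Gamma> n))) UNIV) proj"
    by (simp add: continuous_map_componentwise_UNIV)
  moreover have "proj \<in> topspace pts_top \<rightarrow> {y. \<forall>n. y n = y (Suc n) <#> \<Gamma> n}"
    using proj_odo odo_iff topspace_pts_top by blast
  ultimately show ?thesis
    unfolding odometer_space_def by (rule continuous_map_into_subtopology)
qed

text \<open>Two points that agree at index \<open>k\<close> continue with \<open>h c\<close> and
  \<open>h d\<close>. Equal images put these in one coset of \<open>\<Gamma> (Suc k)\<close>, whence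
  \<open>c = d\<close> by \<open>C_separated\<close>.\<close>

lemma inj_on_proj_cyl: "inj_on proj (cyl n f)"
proof (rule inj_onI)
  fix x z assume xz: "x \<in> cyl n f" "z \<in> cyl n f" "proj x = proj z"
  then have pts: "x \<in> pts" "z \<in> pts"
    by (auto simp: cyl_def)
  have "x k = z k" if "n \<le> k" for k
    using that
  proof (induction k rule: dec_induct)
    case base
    then show ?case
      using xz by (simp add: cyl_def)
  next
    case (step k)
    have xn: "x n = {f}"
      using xz(1) by (simp add: cyl_def)
    obtain h where h: "h \<in> F k" "x k = {h}"
      using pts_later[OF pts(1) xn step.hyps(1)] .
    have zk: "z k = {h}"
      using h(2) step.IH by simp
    obtain c where c: "c \<in> C k" "x (Suc k) = {h \<otimes> c}"
      using pts_Suc[OF pts(1) h(2)] .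
    obtain d where d: "d \<in> C k" "z (Suc k) = {h \<otimes> d}"
      using pts_Suc[OF pts(2) zk] .
    have hcd: "h \<otimes> c \<in> proj x (Suc k)" "h \<otimes> d \<in> proj x (Suc k)"
      using proj_mem[OF pts(1) c(2)] proj_mem[OF pts(2) d(2)] xz(3) by auto
    have car: "h \<in> carrier G" "c \<in> carrier G" "d \<in> carrier G"
      using h c d F_carrier C_carrier by auto
    have "inv (h \<otimes> c) \<otimes> (h \<otimes> d) \<in> \<Gamma> (Suc k)"
      using lcoset_\<Gamma>(3)[OF odo_lcoset[OF proj_odo[OF pts(1)]] hcd(1)] hcd(2) by blast
    moreover have "inv (h \<otimes> c) \<otimes> (h \<otimes> d) = inv c \<otimes> (inv h \<otimes> h \<otimes> d)"
      using car by (simp only: inv_mult_group m_assoc inv_closed m_closed)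
    ultimately have "inv c \<otimes> d \<in> \<Gamma> (Suc k)"
      using car by simp
    then show ?case
      using C_separated c d by auto
  qed
  then show "x = z"
    using pts_eqI[OF pts] unfolding eventually_sequentially by blast
qed

text \<open>A preimage of \<open>y\<close> is built upwards from \<open>f\<close>: if the current
  level lies in \<open>y i\<close>, then \<open>C_exhausts\<close> supplies a factor that moves it
  into the smaller coset \<open>y (Suc i)\<close>.\<close>

lemma proj_cyl:
  assumes "f \<in> F n"
  shows "proj ` cyl n f = {y \<in> odo. f \<in> y n}"
proof
  show "proj ` cyl n f \<subseteq> {y \<in> odo. f \<in> y n}"
    using proj_odo proj_mem by (auto simp: cyl_def)
  show "{y \<in> odo. f \<in> y n} \<subseteq> proj ` cyl n f"
  proof
    fix y assume "y \<in> {y \<in> odo. f \<in> y n}"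
    then have y: "y \<in> odo" "f \<in> y n"
      by auto
    have step: "\<exists>k. k \<in> F (Suc i) \<inter> y (Suc i) \<and> (\<exists>c\<in>C i. k = h \<otimes> c)"
      if hi: "h \<in> F i \<inter> y i" for h i
    proof -
      obtain k where k: "k \<in> carrier G" "k \<in> y (Suc i)"
        using odo_nonempty[OF y(1)] .
      have h: "h \<in> carrier G" "h \<in> y i"
        using hi F_carrier by auto
      have "inv h \<otimes> k \<in> \<Gamma> i"
        using lcoset_\<Gamma>(3)[OF odo_lcoset[OF y(1)] h(2), of k] odo_antimono[OF y(1), of i] k by blast
      then obtain c where c: "c \<in> C i" "inv c \<otimes> (inv h \<otimes> k) \<in> \<Gamma> (Suc i)"
        using C_exhausts by blast
      have ccar: "c \<in> carrier G"
        using c C_carrier by blast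
      have "inv (inv c \<otimes> (inv h \<otimes> k)) \<in> \<Gamma> (Suc i)"
        using c(2) subgroup.m_inv_closed[OF subgroup_\<Gamma>] by blast
      then have "inv k \<otimes> (h \<otimes> c) \<in> \<Gamma> (Suc i)"
        using ccar h k by (simp add: inv_mult_group m_assoc)
      then have "h \<otimes> c \<in> y (Suc i)"
        using lcoset_\<Gamma>(3)[OF odo_lcoset[OF y(1)] k(2), of "h \<otimes> c"] h ccar by simp
      then show ?thesis
        using c(1) hi F_C_closed by blast
    qed
    \<comment> \<open>Dependent choice with indices shifted by \<open>n\<close>; the clause for
      \<open>i = 0\<close> pins the start to \<open>f\<close>.\<close>
    have "\<exists>s. \<forall>i. s i \<in> F (n + i) \<inter> y (n + i) \<and> (i = 0 \<longrightarrow> s i = f) \<and> (\<exists>c\<in>C (n + i). s (Suc i) = s i \<otimes> c)"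
    proof -
      have "\<exists>s. \<forall>i. (s i \<in> F (n + i) \<inter> y (n + i) \<and> (i = 0 \<longrightarrow> s i = f)) \<and> (\<exists>c\<in>C (n + i). s (Suc i) = s i \<otimes> c)"
        by (rule dependent_nat_choice[where Q = "\<lambda>i h k. \<exists>c\<in>C (n + i). k = h \<otimes> c"])
          (use assms y step in auto)
      then show ?thesis
        by blast
    qed
    then obtain s where s: "\<And>i. s i \<in> F (n + i) \<inter> y (n + i)" "s 0 = f"
        "\<And>i. \<exists>c\<in>C (n + i). s (Suc i) = s i \<otimes> c"
      by blast
    have "s (k - n) \<in> F k \<and> (\<exists>c\<in>C k. s (Suc k - n) = s (k - n) \<otimes> c)" if "n \<le> k" for k
      using s(1)[of "k - n"] s(3)[of "k - n"] that by (simp add: Suc_diff_le)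
    then obtain x where x: "x \<in> pts" "\<And>k. n \<le> k \<Longrightarrow> x k = {s (k - n)}"
      using pts_completion[of n "\<lambda>k. s (k - n)"] by blast
    have "proj x k = y k" for k
    proof -
      let ?m = "max k n"
      have m: "x ?m = {s (?m - n)}" "s (?m - n) \<in> y ?m"
        using x(2)[of ?m] s(1)[of "?m - n"] by auto
      have "y ?m \<subseteq> y k"
        using lift_Suc_antimono_le[of y k ?m] odo_antimono[OF y(1)] by simp
      then have "y k = s (?m - n) <# \<Gamma> k"
        using lcoset_\<Gamma>(2)[OF odo_lcoset[OF y(1)]] m(2) by blast
      then show ?thesis
        using proj_level[OF x(1) m(1)] by simp
    qed
    moreover have "x \<in> cyl n f"
      using x(1) x(2)[of n] s(2) by (simp add: cyl_def)
    ultimately show "y \<in> proj ` cyl n f"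
      by (intro image_eqI[of _ _ x]) auto
  qed
qed

text \<open>The cylinder \<open>cyl 0 \<one>\<close> covers only those \<open>y\<close> with
  \<open>\<one>\<close> in \<open>y 0\<close>. Any other point is translated there by a group
  element, and equivariance carries the preimage back.\<close>

lemma proj_surj: "proj ` pts = odo"
proof
  show "proj ` pts \<subseteq> odo"
    using proj_odo by blast
  show "odo \<subseteq> proj ` pts"
  proof
    fix y assume y: "y \<in> odo"
    obtain g where g: "g \<in> carrier G" "g \<in> y 0"
      using odo_nonempty[OF y] .
    let ?z = "\<lambda>n. inv g <# y n"
    have z: "?z \<in> odo"
      using odo_translate[OF y] g(1) by simp
    have "inv g \<otimes> g \<in> inv g <# y 0"
      using g(2) unfolding l_coset_def by blast
    then have "?z \<in> {y \<in> odo. \<one> \<in> y 0}"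
      using z g(1) by simp
    then obtain x where x: "x \<in> pts" "proj x = ?z"
      using proj_cyl[OF one_F[of 0]] cyl_subset[of 0 \<one>] by (metis (no_types, lifting) imageE subsetD)
    have "y n \<subseteq> carrier G" for n
      using odo_lcoset[OF y, of n] lcoset_\<Gamma>(1) by blast
    then have "g <# (inv g <# y n) = y n" for n
      using g(1) by (simp add: lcos_m_assoc lcos_mult_one)
    then have "proj (act g x) = y"
      using proj_act[OF x(1) g(1)] x(2) z by (simp add: odometer_def)
    then show "y \<in> proj ` pts"
      using act_pts[OF x(1) g(1)] by blast
  qed
qed

end

locale odometer_tower_Haar = odometer_tower +
  fixes \<nu> :: "(nat \<Rightarrow> 'a set) measure"
  assumes Haar: "odometer_Haar_measure G \<Gamma> \<nu>"
    and countable_carrier: "countable (carrier G)"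
begin

section \<open>The invariant measure\<close>

lemma sets_\<nu>: "sets \<nu> = sets (borel_of (odometer_space G \<Gamma>))"
  using Haar by (simp add: odometer_Haar_measure_def)

lemma space_\<nu>: "space \<nu> = odo"
  using sets_eq_imp_space_eq[OF sets_\<nu>] by (simp add: space_borel_of)

lemma prob_space_\<nu>: "prob_space \<nu>"
  using Haar by (simp add: odometer_Haar_measure_def)

lemma odometer_measurable: "g \<in> carrier G \<Longrightarrow> odometer G \<Gamma> g \<in> \<nu> \<rightarrow>\<^sub>M \<nu>"
  using Haar by (simp add: odometer_Haar_measure_def measure_preserving_action_def)

lemma odometer_invariant: "g \<in> carrier G \<Longrightarrow> distr \<nu> \<nu> (odometer G \<Gamma> g) = \<nu>"
  using Haar by (simp add: odometer_Haar_measure_def measure_preserving_action_def)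

text \<open>The clopen set over which the cylinder \<open>cyl n f\<close> lies when \<open>f\<close>
  is in \<open>F n\<close>; it makes sense for every group element, so that sheets can be
  translated.\<close>

definition sheet :: "nat \<Rightarrow> 'a \<Rightarrow> (nat \<Rightarrow> 'a set) set" where
  "sheet n f = {y \<in> odo. f \<in> y n}"

lemma sheet_sets: "sheet n f \<in> sets \<nu>"
proof -
  have "continuous_map (odometer_space G \<Gamma>) (discrete_topology (lcosets (\<Gamma> n))) (\<lambda>y. y n)"
    unfolding odometer_space_def
    by (intro continuous_map_from_subtopology continuous_map_product_projection) simp
  then have "openin (odometer_space G \<Gamma>) {y \<in> odo. y n \<in> {A \<in> lcosets (\<Gamma> n). f \<in> A}}"
    by (rule openin_continuous_map_preimage) auto
  moreover have "{y \<in> odo. y n \<in> {A \<in> lcosets (\<Gamma> n). f \<in> A}} = sheet n f"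
    using odo_lcoset by (auto simp: sheet_def)
  ultimately show ?thesis
    by (simp add: sets_\<nu> openin_borel_of)
qed

text \<open>Continuous images of Borel sets need not be Borel. Injectivity on the cylinder makes
  images commute with complements, so induction over the generated sets goes through.\<close>

lemma proj_image_sets:
  assumes "A \<in> sets (borel_of pts_top)"
  shows "proj ` (A \<inter> cyl n f) \<in> sets \<nu>"
proof -
  have cyl: "proj ` cyl m h \<in> sets \<nu>" for m h
    using proj_cyl[of h m] cyl_empty[of h m] sheet_sets[of m h]
    by (cases "h \<in> F m") (auto simp: sheet_def)
  have "A \<in> sigma_sets pts {cyl n f | n f. True}"
    using assms by (simp add: sets_borel_pts_top)
  then show ?thesis
  proof (induction rule: sigma_sets.induct)
    case (Basic A)
    then obtain m h where "A = cyl m h"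
      by auto
    then have "A \<inter> cyl n f \<in> {{}, cyl m h, cyl n f}"
      using cyl_nested by simp
    then show ?case
      using cyl by fastforce
  next
    case (Compl A)
    have "(pts - A) \<inter> cyl n f = cyl n f - (A \<inter> cyl n f)"
      using cyl_subset by blast
    then have "proj ` ((pts - A) \<inter> cyl n f) = proj ` cyl n f - proj ` (A \<inter> cyl n f)"
      using inj_on_image_set_diff[OF inj_on_proj_cyl[of n f], of "cyl n f" "A \<inter> cyl n f"] by simp
    then show ?case
      using cyl Compl.IH by simp
  next
    case (Union A)
    have "proj ` ((\<Union>i. A i) \<inter> cyl n f) = (\<Union>i. proj ` (A i \<inter> cyl n f))"
      by blast
    then show ?case
      using Union.IH by auto
  qed simp
qed

text \<open>
  The projection is injective on each cylinder, so its fibres are countable and the measure on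
  the tower space counts the points of the fibres, integrated over the odometer.
\<close>

definition fibre_count :: "(nat \<Rightarrow> 'a set) set \<Rightarrow> (nat \<Rightarrow> 'a set) \<Rightarrow> ennreal" where
  "fibre_count A y = emeasure (count_space UNIV) (A \<inter> proj -` {y})"

definition \<mu> :: "(nat \<Rightarrow> 'a set) measure" where
  "\<mu> = measure_of pts (sets (borel_of pts_top)) (\<lambda>A. \<integral>\<^sup>+ y. fibre_count A y \<partial>\<nu>)"

lemma fibre_count_cyl:
  "fibre_count (A \<inter> cyl n f) y = indicator (proj ` (A \<inter> cyl n f)) y"
proof (cases "y \<in> proj ` (A \<inter> cyl n f)")
  case True
  then obtain x where x: "x \<in> A \<inter> cyl n f" "proj x = y"
    by blast
  then have "A \<inter> cyl n f \<inter> proj -` {y} = {x}"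
    using inj_onD[OF inj_on_proj_cyl[of n f]] by blast
  then show ?thesis
    using True by (simp add: fibre_count_def)
next
  case False
  then have "A \<inter> cyl n f \<inter> proj -` {y} = {}"
    by blast
  then show ?thesis
    using False by (simp add: fibre_count_def)
qed

text \<open>The unions of the levels of the towers increase to the whole space, and each level holds
  at most one point of the fibre. The formula serves to show that the count is measurable.\<close>

lemma fibre_count_SUP:
  assumes "A \<subseteq> pts"
  shows "fibre_count A y = (SUP n. \<Sum>f\<in>F n. indicator (proj ` (A \<inter> cyl n f)) y)"
proof -
  define E where "E n = (\<Union>f\<in>F n. A \<inter> cyl n f \<inter> proj -` {y})" for n
  have "E n \<subseteq> E (Suc n)" for n
  proof
    fix x assume "x \<in> E n"
    then obtain f where f: "f \<in> F n" "x \<in> A \<inter> proj -` {y}" "x \<in> cyl n f"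
      by (auto simp: E_def)
    then obtain c where "c \<in> C n" "x \<in> cyl (Suc n) (f \<otimes> c)"
      using cyl_Suc[OF f(1)] by blast
    then show "x \<in> E (Suc n)"
      using f F_C_closed[OF f(1)] by (auto simp: E_def)
  qed
  then have "incseq E"
    by (rule incseq_SucI)
  then have "(SUP n. emeasure (count_space UNIV) (E n)) = emeasure (count_space UNIV) (\<Union>n. E n)"
    by (intro SUP_emeasure_incseq) auto
  moreover have "(\<Union>n. E n) = A \<inter> proj -` {y}"
  proof (intro equalityI subsetI)
    fix x assume x: "x \<in> A \<inter> proj -` {y}"
    then have "x \<in> pts"
      using assms by blast
    then obtain n f where "f \<in> F n" "x n = {f}"
      by (rule pts_start)
    then show "x \<in> (\<Union>n. E n)"
      using x \<open>x \<in> pts\<close> unfolding E_def cyl_def by blast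
  qed (auto simp: E_def)
  moreover have "emeasure (count_space UNIV) (E n) = (\<Sum>f\<in>F n. indicator (proj ` (A \<inter> cyl n f)) y)" for n
  proof -
    have "disjoint_family_on (\<lambda>f. A \<inter> cyl n f \<inter> proj -` {y}) (F n)"
      using cyl_disjoint by (fastforce simp: disjoint_family_on_def)
    then have "emeasure (count_space UNIV) (E n) = (\<Sum>f\<in>F n. fibre_count (A \<inter> cyl n f) y)"
      unfolding E_def fibre_count_def by (intro sum_emeasure[symmetric]) (auto simp: finite_F)
    then show ?thesis
      by (simp add: fibre_count_cyl)
  qed
  ultimately show ?thesis
    by (simp add: fibre_count_def)
qed

lemma borel_pts_subset: "A \<in> sets (borel_of pts_top) \<Longrightarrow> A \<subseteq> pts"
  using sets.sets_into_space[of A "borel_of pts_top"] by (simp add: space_borel_of topspace_pts_top)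

lemma fibre_count_measurable:
  assumes "A \<in> sets (borel_of pts_top)"
  shows "fibre_count A \<in> borel_measurable \<nu>"
proof -
  have "(\<lambda>y. SUP n. \<Sum>f\<in>F n. indicator (proj ` (A \<inter> cyl n f)) y :: ennreal) \<in> borel_measurable \<nu>"
    using proj_image_sets[OF assms] by (intro borel_measurable_SUP borel_measurable_sum) auto
  moreover have "fibre_count A = (\<lambda>y. SUP n. \<Sum>f\<in>F n. indicator (proj ` (A \<inter> cyl n f)) y)"
    using fibre_count_SUP[OF borel_pts_subset[OF assms]] by blast
  ultimately show ?thesis
    by simp
qed

lemma sets_\<mu>: "sets \<mu> = sets (borel_of pts_top)"
  using sets.sigma_sets_eq[of "borel_of pts_top"] borel_pts_subset unfolding \<mu>_def
  by (subst sets_measure_of) (auto simp: space_borel_of topspace_pts_top)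

lemma space_\<mu>: "space \<mu> = pts"
  using sets_eq_imp_space_eq[OF sets_\<mu>] by (simp add: space_borel_of topspace_pts_top)

text \<open>Counting is countably additive in each fibre, and the sum passes through the integral
  for nonnegative measurable functions.\<close>

lemma emeasure_\<mu>:
  assumes "A \<in> sets (borel_of pts_top)"
  shows "emeasure \<mu> A = (\<integral>\<^sup>+ y. fibre_count A y \<partial>\<nu>)"
  unfolding \<mu>_def
proof (rule emeasure_measure_of_sigma)
  show "sigma_algebra pts (sets (borel_of pts_top))"
    using sets.sigma_algebra_axioms[of "borel_of pts_top"] by (simp add: space_borel_of topspace_pts_top)
  show "positive (sets (borel_of pts_top)) (\<lambda>A. \<integral>\<^sup>+ y. fibre_count A y \<partial>\<nu>)"
    by (simp add: positive_def fibre_count_def)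
  show "countably_additive (sets (borel_of pts_top)) (\<lambda>A. \<integral>\<^sup>+ y. fibre_count A y \<partial>\<nu>)"
  proof (rule countably_additiveI)
    fix A :: "nat \<Rightarrow> (nat \<Rightarrow> 'a set) set"
    assume A: "range A \<subseteq> sets (borel_of pts_top)" "disjoint_family A"
    have "(\<Sum>i. \<integral>\<^sup>+ y. fibre_count (A i) y \<partial>\<nu>) = (\<integral>\<^sup>+ y. (\<Sum>i. fibre_count (A i) y) \<partial>\<nu>)"
      using A(1) fibre_count_measurable by (intro nn_integral_suminf[symmetric]) auto
    also have "\<dots> = (\<integral>\<^sup>+ y. fibre_count (\<Union>i. A i) y \<partial>\<nu>)"
    proof (rule nn_integral_cong)
      fix y
      have "(\<Sum>i. fibre_count (A i) y) = emeasure (count_space UNIV) (\<Union>i. A i \<inter> proj -` {y})"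
        unfolding fibre_count_def
      proof (rule suminf_emeasure)
        show "disjoint_family (\<lambda>i. A i \<inter> proj -` {y})"
          using A(2) unfolding disjoint_family_on_def by blast
      qed simp
      also have "(\<Union>i. A i \<inter> proj -` {y}) = (\<Union>i. A i) \<inter> proj -` {y}"
        by blast
      finally show "(\<Sum>i. fibre_count (A i) y) = fibre_count (\<Union>i. A i) y"
        unfolding fibre_count_def .
    qed
    finally show "(\<Sum>i. \<integral>\<^sup>+ y. fibre_count (A i) y \<partial>\<nu>) = (\<integral>\<^sup>+ y. fibre_count (\<Union>i. A i) y \<partial>\<nu>)" .
  qed
qed (rule assms)

lemma cyl_sets: "cyl n f \<in> sets (borel_of pts_top)"
  using openin_cyl by (rule openin_borel_of)

lemma emeasure_cyl:
  assumes "f \<in> F n"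
  shows "emeasure \<mu> (cyl n f) = emeasure \<nu> (sheet n f)"
proof -
  have "fibre_count (cyl n f) = indicator (sheet n f)"
    using fibre_count_cyl[of UNIV n f] proj_cyl[OF assms] by (simp add: fun_eq_iff sheet_def)
  then show ?thesis
    using emeasure_\<mu>[OF cyl_sets, of n f] sheet_sets by simp
qed

lemma act_measurable: "g \<in> carrier G \<Longrightarrow> act g \<in> \<mu> \<rightarrow>\<^sub>M \<mu>"
  using continuous_map_measurable[OF act_continuous] measurable_cong_sets[OF sets_\<mu> sets_\<mu>] by blast

text \<open>\<open>act g\<close> maps the fibre over \<open>y\<close> bijectively onto the fibre
  over the translate of \<open>y\<close>. So the count of the preimage of \<open>A\<close> is the
  count of \<open>A\<close> composed with the odometer, and invariance of \<open>\<nu>\<close>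
  concludes.\<close>

lemma act_invariant:
  assumes g: "g \<in> carrier G"
  shows "distr \<mu> \<mu> (act g) = \<mu>"
proof (rule measure_eqI)
  fix A assume "A \<in> sets (distr \<mu> \<mu> (act g))"
  then have A: "A \<in> sets (borel_of pts_top)"
    by (simp add: sets_\<mu>)
  let ?B = "act g -` A \<inter> pts"
  have B: "?B \<in> sets (borel_of pts_top)"
    using measurable_sets[OF act_measurable[OF g], of A] A by (simp add: sets_\<mu> space_\<mu>)
  have count: "fibre_count ?B y = fibre_count A (odometer G \<Gamma> g y)" if y: "y \<in> odo" for y
  proof -
    have inj: "proj x = y" if "x \<in> pts" "odometer G \<Gamma> g (proj x) = odometer G \<Gamma> g y" for x
    proof -
      have "g <# proj x n = g <# y n" for n
        using that(2) proj_odo[OF that(1)] y by (simp add: odometer_def fun_eq_iff)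
      then have "inv g <# (g <# proj x n) = inv g <# (g <# y n)" for n
        by simp
      moreover have "proj x n \<subseteq> carrier G" "y n \<subseteq> carrier G" for n
        using odo_lcoset[OF y, of n] odo_lcoset[OF proj_odo[OF that(1)], of n] lcoset_\<Gamma>(1) by blast+
      ultimately show ?thesis
        using g by (simp add: lcos_m_assoc lcos_mult_one fun_eq_iff)
    qed
    have "bij_betw (act g) (?B \<inter> proj -` {y}) (A \<inter> proj -` {odometer G \<Gamma> g y})"
    proof (rule bij_betw_imageI)
      show "inj_on (act g) (?B \<inter> proj -` {y})"
        using bij_betw_imp_inj_on[OF act_bij[OF g]] by (rule inj_on_subset) blast
      show "act g ` (?B \<inter> proj -` {y}) = A \<inter> proj -` {odometer G \<Gamma> g y}"
      proof (intro equalityI subsetI)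
        fix z assume "z \<in> act g ` (?B \<inter> proj -` {y})"
        then show "z \<in> A \<inter> proj -` {odometer G \<Gamma> g y}"
          using proj_act[OF _ g] by auto
      next
        fix z assume z: "z \<in> A \<inter> proj -` {odometer G \<Gamma> g y}"
        then have "z \<in> pts"
          using borel_pts_subset[OF A] by blast
        then have x: "act (inv g) z \<in> pts" "act g (act (inv g) z) = z"
          using act_pts act_inv(1) g by auto
        have "odometer G \<Gamma> g (proj (act (inv g) z)) = odometer G \<Gamma> g y"
          using z x(2) proj_act[OF x(1) g] by simp
        then have "proj (act (inv g) z) = y"
          by (rule inj[OF x(1)])
        then show "z \<in> act g ` (?B \<inter> proj -` {y})"
          using x z by (intro image_eqI[of _ _ "act (inv g) z"]) auto
      qed
    qed
    then show ?thesis
      unfolding fibre_count_def by (simp add: emeasure_count_space bij_betw_finite bij_betw_same_card)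
  qed
  have "emeasure (distr \<mu> \<mu> (act g)) A = emeasure \<mu> ?B"
    using A by (simp add: emeasure_distr[OF act_measurable[OF g]] sets_\<mu> space_\<mu>)
  also have "\<dots> = (\<integral>\<^sup>+ y. fibre_count A (odometer G \<Gamma> g y) \<partial>\<nu>)"
    unfolding emeasure_\<mu>[OF B] using count by (intro nn_integral_cong) (simp add: space_\<nu>)
  also have "\<dots> = (\<integral>\<^sup>+ y. fibre_count A y \<partial>distr \<nu> \<nu> (odometer G \<Gamma> g))"
    using fibre_count_measurable[OF A] by (intro nn_integral_distr[symmetric] odometer_measurable g) simp
  also have "\<dots> = emeasure \<mu> A"
    by (simp add: odometer_invariant[OF g] emeasure_\<mu>[OF A])
  finally show "emeasure (distr \<mu> \<mu> (act g)) A = emeasure \<mu> A" .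
qed simp

text \<open>The preimage of \<open>sheet n f\<close> under translation by \<open>f\<close> is
  \<open>sheet n \<one>\<close>.\<close>

lemma emeasure_sheet:
  assumes "f \<in> carrier G"
  shows "emeasure \<nu> (sheet n f) = emeasure \<nu> (sheet n \<one>)"
proof -
  have "odometer G \<Gamma> f -` sheet n f \<inter> space \<nu> = sheet n \<one>"
  proof -
    have "f \<in> f <# y n \<longleftrightarrow> \<one> \<in> y n" if "y \<in> odo" for y
    proof -
      have "y n \<subseteq> carrier G"
        using odo_lcoset[OF that, of n] lcoset_\<Gamma>(1) by blast
      then have "f = f \<otimes> h \<longleftrightarrow> h = \<one>" if "h \<in> y n" for h
        using that assms by (simp add: subset_iff)
      then show ?thesis
        unfolding l_coset_def by blast
    qed
    then show ?thesis
      using odo_translate[OF _ assms] by (auto simp: sheet_def space_\<nu> odometer_def)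
  qed
  then show ?thesis
    using emeasure_distr[OF odometer_measurable[OF assms] sheet_sets, of n f]
    by (simp add: odometer_invariant[OF assms])
qed

text \<open>Countably many sheets of equal mass cover a probability space.\<close>

lemma emeasure_sheet_pos: "emeasure \<nu> (sheet n \<one>) > 0"
proof (rule ccontr)
  assume "\<not> ?thesis"
  then have "sheet n f \<in> null_sets \<nu>" if "f \<in> carrier G" for f
    using emeasure_sheet[OF that, of n] sheet_sets by (auto intro: null_setsI)
  then have "(\<Union>f\<in>carrier G. sheet n f) \<in> null_sets \<nu>"
    using countable_carrier by (rule null_sets_UN'[rotated])
  moreover have "(\<Union>f\<in>carrier G. sheet n f) = space \<nu>"
  proof (intro equalityI subsetI)
    fix y assume "y \<in> space \<nu>"
    then have y: "y \<in> odo"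
      by (simp add: space_\<nu>)
    obtain h where "h \<in> carrier G" "h \<in> y n"
      using odo_nonempty[OF y] .
    then show "y \<in> (\<Union>f\<in>carrier G. sheet n f)"
      using y by (auto simp: sheet_def)
  qed (auto simp: sheet_def space_\<nu>)
  ultimately show False
    using prob_space.emeasure_space_1[OF prob_space_\<nu>] by auto
qed

text \<open>The factor 1/2 is the least possible drop: a nontrivial \<open>c\<close> in
  \<open>C n\<close> gives a second, disjoint sheet of index \<open>Suc n\<close> and of the same
  mass inside \<open>sheet n \<one>\<close>.\<close>

lemma emeasure_sheet_le: "emeasure \<nu> (sheet n \<one>) \<le> ennreal ((1/2) ^ n)"
proof -
  interpret prob_space \<nu>
    by (rule prob_space_\<nu>)
  have "prob (sheet n \<one>) \<le> (1/2) ^ n"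
  proof (induction n)
    case (Suc n)
    obtain c where c: "c \<in> C n" "c \<noteq> \<one>"
      using C_nontrivial by blast
    have "sheet (Suc n) \<one> \<union> sheet (Suc n) c \<subseteq> sheet n \<one>"
    proof
      fix y assume y: "y \<in> sheet (Suc n) \<one> \<union> sheet (Suc n) c"
      then have odo: "y \<in> odo" and "\<one> \<in> y n \<or> c \<in> y n"
        using odo_antimono[of y n] by (auto simp: sheet_def)
      moreover have "\<one> \<in> y n" if "c \<in> y n"
      proof -
        have "inv c \<otimes> \<one> \<in> \<Gamma> n"
          using c(1) C_subset C_carrier subgroup.m_inv_closed[OF subgroup_\<Gamma>, of c n] by auto
        then show ?thesis
          using lcoset_\<Gamma>(3)[OF odo_lcoset[OF odo] that] by simp
      qed
      ultimately show "y \<in> sheet n \<one>"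
        by (auto simp: sheet_def)
    qed
    then have "prob (sheet (Suc n) \<one> \<union> sheet (Suc n) c) \<le> prob (sheet n \<one>)"
      using sheet_sets by (rule finite_measure_mono)
    moreover have "sheet (Suc n) \<one> \<inter> sheet (Suc n) c = {}"
    proof (rule ccontr)
      assume "\<not> ?thesis"
      then obtain y where y: "y \<in> odo" "\<one> \<in> y (Suc n)" "c \<in> y (Suc n)"
        by (auto simp: sheet_def)
      then have "inv \<one> \<otimes> c \<in> \<Gamma> (Suc n)"
        using lcoset_\<Gamma>(3)[OF odo_lcoset[OF y(1)] y(2)] by blast
      then show False
        using C_separated[OF one_C c(1)] c(2) by blast
    qed
    moreover have "prob (sheet (Suc n) c) = prob (sheet (Suc n) \<one>)"
      using emeasure_sheet[OF C_carrier[OF c(1)]] by (simp add: measure_def)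
    ultimately have "2 * prob (sheet (Suc n) \<one>) \<le> prob (sheet n \<one>)"
      using finite_measure_Union[of "sheet (Suc n) \<one>" "sheet (Suc n) c"] sheet_sets by simp
    then show ?case
      using Suc.IH by simp
  qed simp
  then show ?thesis
    by (simp add: emeasure_eq_measure ennreal_leI)
qed

section \<open>Small cylinders: sigma-finiteness and absence of atoms\<close>

lemma emeasure_cyl_le: "emeasure \<mu> (cyl n f) \<le> ennreal ((1/2) ^ n)"
  using emeasure_cyl[of f n] emeasure_sheet[of f n] emeasure_sheet_le[of n] F_carrier[of f n] cyl_empty[of f n]
  by (cases "f \<in> F n") auto

text \<open>The starting index \<open>k\<close> is free: 0 suffices for sigma-finiteness, and a
  large \<open>k\<close> makes all covering sets small, which excludes atoms.\<close>

lemma cyl_cover: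
  shows "countable {cyl n f | n f. k \<le> n \<and> f \<in> F n}" "\<Union>{cyl n f | n f. k \<le> n \<and> f \<in> F n} = pts"
proof -
  have "{cyl n f | n f. k \<le> n \<and> f \<in> F n} \<subseteq> (\<lambda>(n, f). cyl n f) ` (SIGMA n:UNIV. F n)"
    by auto
  then show "countable {cyl n f | n f. k \<le> n \<and> f \<in> F n}"
    by (rule countable_subset)
      (intro countable_image countable_SIGMA, auto simp: finite_F countable_finite)
  have "x \<in> \<Union>{cyl n f | n f. k \<le> n \<and> f \<in> F n}" if x: "x \<in> pts" for x
  proof -
    obtain m f where "k \<le> m" "f \<in> F m" "x m = {f}"
      using pts_reach[OF x] .
    then show ?thesis
      using x unfolding cyl_def by blast
  qed
  then show "\<Union>{cyl n f | n f. k \<le> n \<and> f \<in> F n} = pts"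
    using cyl_subset by blast
qed

lemma sigma_finite_\<mu>: "sigma_finite_measure \<mu>"
proof
  have "emeasure \<mu> (cyl n f) \<noteq> \<infinity>" for n f
    using emeasure_cyl_le[of n f] by (auto simp: top_unique)
  then show "\<exists>A. countable A \<and> A \<subseteq> sets \<mu> \<and> \<Union>A = space \<mu> \<and> (\<forall>a\<in>A. emeasure \<mu> a \<noteq> \<infinity>)"
    using cyl_cover[of 0] cyl_sets
    by (intro exI[of _ "{cyl n f | n f. 0 \<le> n \<and> f \<in> F n}"]) (auto simp: sets_\<mu> space_\<mu>)
qed

lemma non_atomic_\<mu>: "non_atomic \<mu>"
proof (rule non_atomicI)
  fix e :: real assume "0 < e"
  then obtain k where k: "(1/2) ^ k < e"
    using real_arch_pow_inv[of e "1/2"] by auto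
  have "emeasure \<mu> (cyl n f) \<le> ennreal e" if "k \<le> n" for n f
  proof -
    have "(1/2) ^ n \<le> ((1/2) ^ k :: real)"
      using that by (intro power_decreasing) auto
    then have "ennreal ((1/2) ^ n) \<le> ennreal e"
      using k by (intro ennreal_leI) linarith
    then show ?thesis
      using emeasure_cyl_le order_trans by blast
  qed
  then show "\<exists>\<C>. countable \<C> \<and> \<C> \<subseteq> sets \<mu> \<and> space \<mu> \<subseteq> \<Union>\<C> \<and> (\<forall>B\<in>\<C>. emeasure \<mu> B \<le> ennreal e)"
    using cyl_cover[of k] cyl_sets
    by (intro exI[of _ "{cyl n f | n f. k \<le> n \<and> f \<in> F n}"]) (auto simp: sets_\<mu> space_\<mu>)
qed

lemma act_measure_preserving: "measure_preserving_action G \<mu> act"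
  using act_group_action act_measurable act_invariant
  by (simp add: measure_preserving_action_def space_\<mu>)

lemma proj_measurable: "proj \<in> \<mu> \<rightarrow>\<^sub>M \<nu>"
  using continuous_map_measurable[OF proj_continuous] measurable_cong_sets[OF sets_\<mu> sets_\<nu>] by blast

text \<open>The mass of the preimage of \<open>N\<close> is the integral of its fibre count. By
  surjectivity this count is positive exactly on \<open>N\<close>, so the integral vanishes just
  when \<open>N\<close> is null; infinite counts do no harm.\<close>

lemma proj_null_sets: "null_sets (distr \<mu> \<nu> proj) = null_sets \<nu>"
proof -
  have "N \<in> null_sets (distr \<mu> \<nu> proj) \<longleftrightarrow> N \<in> null_sets \<nu>" if N: "N \<in> sets \<nu>" for N
  proof -
    let ?A = "proj -` N \<inter> pts"
    have A: "?A \<in> sets (borel_of pts_top)"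
      using measurable_sets[OF proj_measurable N] by (simp add: sets_\<mu> space_\<mu>)
    have count: "fibre_count ?A y = 0 \<longleftrightarrow> y \<notin> N" if "y \<in> odo" for y
    proof -
      have "y \<in> proj ` pts"
        using that by (simp add: proj_surj)
      then obtain x where "x \<in> pts" "proj x = y"
        by blast
      then have "?A \<inter> proj -` {y} = {} \<longleftrightarrow> y \<notin> N"
        by blast
      then show ?thesis
        by (simp add: fibre_count_def emeasure_count_space_eq_0)
    qed
    have "N \<in> null_sets (distr \<mu> \<nu> proj) \<longleftrightarrow> emeasure \<mu> ?A = 0"
      unfolding null_sets_distr_iff[OF proj_measurable]
      using N A by (auto simp: space_\<mu> sets_\<mu> intro: null_setsI)
    also have "\<dots> \<longleftrightarrow> (AE y in \<nu>. fibre_count ?A y = 0)"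
      using nn_integral_0_iff_AE[OF fibre_count_measurable[OF A]] by (simp add: emeasure_\<mu>[OF A])
    also have "\<dots> \<longleftrightarrow> (AE y in \<nu>. y \<notin> N)"
      using count by (intro AE_cong) (simp add: space_\<nu>)
    also have "\<dots> \<longleftrightarrow> N \<in> null_sets \<nu>"
      using AE_iff_null_sets[OF N] by simp
    finally show ?thesis .
  qed
  moreover have "N \<in> null_sets (distr \<mu> \<nu> proj) \<Longrightarrow> N \<in> sets \<nu>" for N
    using null_setsD2 by fastforce
  ultimately show ?thesis
    using null_setsD2 by blast
qed

lemma proj_equivalent: "equivalent_measures (distr \<mu> \<nu> proj) \<nu>"
  by (simp add: equivalent_measures_def proj_null_sets)

lemma proj_factor: "factor_map G \<mu> act \<nu> (odometer G \<Gamma>) proj"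
  using proj_measurable proj_act proj_equivalent by (auto simp: factor_map_def space_\<mu> intro!: AE_I2)

section \<open>Rank one\<close>

lemma act_base:
  assumes "f \<in> F n"
  shows "act f ` cyl n \<one> = cyl n f"
  using act_cyl[OF one_F, of f n] assms F_carrier by simp

lemma tower_Rokhlin: "Rokhlin_tower G \<mu> act (cyl n \<one>) (F n)"
  unfolding Rokhlin_tower_def
proof (intro conjI ballI)
  show "0 < emeasure \<mu> (cyl n \<one>)"
    using emeasure_cyl[OF one_F] emeasure_sheet_pos by simp
  show "emeasure \<mu> (cyl n \<one>) < \<infinity>"
    using emeasure_cyl_le[of n \<one>] by (simp add: le_less_trans)
  show "disjoint_family_on (\<lambda>f. act f ` cyl n \<one>) (F n)"
    unfolding disjoint_family_on_def using act_base cyl_disjoint by metis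
  fix f assume "f \<in> F n"
  then have "distr \<mu> \<mu> (act (inv f)) = \<mu>"
    using act_invariant F_carrier by simp
  then have "AE x in \<mu>. x \<in> cyl n \<one> \<longrightarrow> RN_deriv \<mu> (distr \<mu> \<mu> (act (inv f))) x = 1"
    using sigma_finite_measure.AE_RN_deriv_self[OF sigma_finite_\<mu>] by (auto elim: AE_mp)
  then show "\<exists>c. AE x in \<mu>. x \<in> cyl n \<one> \<longrightarrow> RN_deriv \<mu> (distr \<mu> \<mu> (act (inv f))) x = c" ..
qed (use cyl_sets sets_\<mu> finite_F F_subset one_F in auto)

lemma tower_partition_cyl: "tower_partition act (cyl n \<one>) (F n) = cyl n ` F n"
  unfolding tower_partition_def by (rule image_cong) (auto simp: act_base)

text \<open>Every condition holds at every point, so the exceptional null set is empty: a point has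
  nonempty entries at arbitrarily late indices, and these fix all its entries.\<close>

lemma rank_one_along_F: "rank_one_along G \<mu> act F"
  unfolding rank_one_along_def
proof (intro exI[of _ "\<lambda>n. cyl n \<one>"] conjI allI)
  fix n
  show "cyl (Suc n) \<one> \<subseteq> cyl n \<one>"
    using cyl_Suc[OF one_F[of n]] one_C[of n] by fastforce
  show "Rokhlin_tower G \<mu> act (cyl n \<one>) (F n)"
    by (rule tower_Rokhlin)
  show "unions_refined_by (tower_partition act (cyl n \<one>) (F n))
          (tower_partition act (cyl (Suc n) \<one>) (F (Suc n)))"
    unfolding unions_refined_by_def tower_partition_cyl
  proof
    fix A assume "A \<in> cyl n ` F n"
    then obtain f where f: "f \<in> F n" "A = cyl n f"
      by blast
    then have "(\<lambda>c. cyl (Suc n) (f \<otimes> c)) ` C n \<subseteq> cyl (Suc n) ` F (Suc n)"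
      using F_C_closed by blast
    moreover have "A = \<Union>((\<lambda>c. cyl (Suc n) (f \<otimes> c)) ` C n)"
      using f cyl_Suc by simp
    ultimately show "\<exists>\<C>\<subseteq>cyl (Suc n) ` F (Suc n). A = \<Union>\<C>"
      by blast
  qed
next
  show "joins_to_points \<mu> (\<lambda>n. tower_partition act (cyl n \<one>) (F n))"
    unfolding joins_to_points_def tower_partition_cyl
  proof (intro bexI[of _ "{}"] ballI conjI)
    fix x assume "x \<in> space \<mu> - {}"
    then have x: "x \<in> pts"
      by (simp add: space_\<mu>)
    have cov: "\<exists>m\<ge>k. \<exists>f\<in>F m. x \<in> cyl m f" for k
    proof -
      obtain m f where "k \<le> m" "f \<in> F m" "x m = {f}"
        using pts_reach[OF x] .
      then show ?thesis
        using x unfolding cyl_def by blast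
    qed
    then show "x \<in> (\<Union>n. \<Union>(cyl n ` F n))"
      by blast
    have "z = x" if z: "z \<in> \<Inter>{A \<in> (\<Union>n. cyl n ` F n). x \<in> A}" for z
    proof
      fix k
      obtain m f where m: "k \<le> m" "f \<in> F m" "x \<in> cyl m f"
        using cov by blast
      then have "z \<in> cyl m f"
        using z by blast
      then show "z k = x k"
        using m pts_eq_below[of z x m k] by (simp add: cyl_def)
    qed
    then show "\<Inter>{A \<in> (\<Union>n. cyl n ` F n). x \<in> A} - {} = {x}"
      by blast
  qed simp
  show "AE x in \<mu>. orbit G act x = (\<Union>n\<in>{1..}. tower_orbit G act (cyl n \<one>) (F n) x)"
  proof (rule AE_I2)
    fix x assume "x \<in> space \<mu>"
    then have x: "x \<in> pts"
      by (simp add: space_\<mu>)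
    show "orbit G act x = (\<Union>n\<in>{1..}. tower_orbit G act (cyl n \<one>) (F n) x)"
    proof (intro equalityI subsetI)
      fix z assume "z \<in> orbit G act x"
      then obtain g where g: "g \<in> carrier G" "z = act g x"
        unfolding orbit_def by blast
      \<comment> \<open>The bound 1 matches the union of tower orbits, which starts at 1. Both
        \<open>f\<close> and \<open>g f\<close> lie in \<open>F m\<close>, so
        \<open>g = (g f) (inv f)\<close> has the form required there.\<close>
      obtain m f where m: "1 \<le> m" "f \<in> F m" "x m = {f}" "g \<otimes> f \<in> F m"
        using act_reach[OF x g(1)] .
      have "x \<in> act f ` cyl m \<one>"
        unfolding act_base[OF m(2)] using x m(3) by (simp add: cyl_def)
      moreover have "z = act (g \<otimes> f \<otimes> inv f) x"
        using g m(2) F_carrier by (simp add: m_assoc)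
      ultimately have "z \<in> tower_orbit G act (cyl m \<one>) (F m) x"
        unfolding tower_orbit_def using m by blast
      then show "z \<in> (\<Union>n\<in>{1..}. tower_orbit G act (cyl n \<one>) (F n) x)"
        using m(1) by blast
    next
      fix z assume "z \<in> (\<Union>n\<in>{1..}. tower_orbit G act (cyl n \<one>) (F n) x)"
      then obtain n k f where "k \<in> F n" "f \<in> F n" "z = act (k \<otimes> inv f) x"
        unfolding tower_orbit_def by blast
      then show "z \<in> orbit G act x"
        unfolding orbit_def using F_carrier by blast
    qed
  qed
qed

lemma act_rank_one: "rank_one_action G \<mu> act"
  unfolding rank_one_action_def
proof (intro conjI)
  show "standard_space \<mu>"
    unfolding standard_space_def
    using completely_metrizable_pts_top second_countable_pts_top sets_\<mu> by blast
  show "nonsingular_action G \<mu> act"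
    using act_measure_preserving
    by (simp add: nonsingular_action_def measure_preserving_action_def equivalent_measures_def)
  show "free_action G \<mu> act"
    unfolding free_action_def
  proof (rule AE_I2)
    fix x assume "x \<in> space \<mu>"
    then show "stabilizer G act x = {\<one>}"
      using act_free act_one by (auto simp: stabilizer_def space_\<mu>)
  qed
  show "\<exists>F. F 0 = {\<one>} \<and> (\<forall>n. F n \<subseteq> F (Suc n) \<and> finite (F n) \<and> F n \<subseteq> carrier G) \<and> rank_one_along G \<mu> act F"
    using F_0 F_Suc finite_F F_subset rank_one_along_F by blast
qed (fact sigma_finite_\<mu> non_atomic_\<mu>)+

end

section \<open>Existence of a tower sequence\<close>

text \<open>A greedy choice: each new representative has to avoid only \<open>B\<close> and the
  finitely many elements in conflict with earlier picks.\<close>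

lemma finite_choice_avoiding:
  assumes "finite \<Q>" "\<And>Q. Q \<in> \<Q> \<Longrightarrow> infinite Q" "finite B"
    and fin: "\<And>x. finite {y. P x y}" and sym: "\<And>x y. P x y \<Longrightarrow> P y x"
  shows "\<exists>r. (\<forall>Q\<in>\<Q>. r Q \<in> Q - B) \<and> (\<forall>Q\<in>\<Q>. \<forall>R\<in>\<Q>. Q \<noteq> R \<longrightarrow> \<not> P (r Q) (r R))"
  using assms(1,2)
proof (induction \<Q> rule: finite_induct)
  case (insert Q \<Q>)
  then obtain r where r: "\<forall>Q\<in>\<Q>. r Q \<in> Q - B" "\<forall>Q\<in>\<Q>. \<forall>R\<in>\<Q>. Q \<noteq> R \<longrightarrow> \<not> P (r Q) (r R)"
    by auto
  have "infinite (Q - (B \<union> (\<Union>R\<in>\<Q>. {y. P (r R) y})))"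
    using insert.hyps(1) insert.prems[of Q] assms(3) fin by (intro Diff_infinite_finite) auto
  then have "Q - (B \<union> (\<Union>R\<in>\<Q>. {y. P (r R) y})) \<noteq> {}"
    by (rule infinite_imp_nonempty)
  then obtain q where q: "q \<in> Q - B" "\<forall>R\<in>\<Q>. \<not> P (r R) q"
    by blast
  have "\<forall>R\<in>\<Q>. \<not> P q (r R)"
    using q(2) sym by blast
  then show ?case
    using r q insert.hyps(2) by (intro exI[of _ "r(Q := q)"]) auto
qed simp

text \<open>One finite coset makes \<open>H\<close> finite, hence all cosets, and finitely many of
  them fill the group.\<close>

lemma (in group) infinite_finite_index:
  assumes "subgroup H G" "finite (lcosets H)" "infinite (carrier G)" "A \<in> lcosets H"
  shows "infinite A"
proof
  assume A: "finite A"
  obtain a where a: "a \<in> carrier G" "A = a <# H"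
    using assms(4) by (auto simp: LCOSETS_def)
  have H: "H \<subseteq> carrier G"
    using assms(1) by (rule subgroup.subset)
  have "H = inv a <# A"
    using a H by (simp add: lcos_m_assoc lcos_mult_one)
  also have "\<dots> = (\<otimes>) (inv a) ` A"
    by (auto simp: l_coset_def)
  finally have "finite H"
    using A by simp
  then have "finite Q" if "Q \<in> lcosets H" for Q
    using that by (auto simp: LCOSETS_def l_coset_def)
  then have "finite (\<Union>(lcosets H))"
    using assms(2) by blast
  then show False
    using assms(3) lcosets_part_G[OF assms(1)] by simp
qed

text \<open>
  The cosets of \<open>K\<close> are infinite, so representatives can be chosen one after another, off the
  finitely many elements for which two translates of \<open>F\<close> would meet.
\<close>

lemma (in group) separated_transversal:
  assumes H: "subgroup H G" and K: "subgroup K G" "K \<subset> H" "finite (lcosets K)"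
    and inf: "infinite (carrier G)" and F: "finite F" "F \<subseteq> carrier G"
  shows "\<exists>C. finite C \<and> C \<subseteq> H \<and> \<one> \<in> C \<and> (\<exists>c\<in>C. c \<noteq> \<one>) \<and> (\<forall>h\<in>H. \<exists>c\<in>C. inv c \<otimes> h \<in> K) \<and>
    (\<forall>c\<in>C. \<forall>d\<in>C. inv c \<otimes> d \<in> K \<longrightarrow> c = d) \<and>
    (\<forall>f\<in>F. \<forall>h\<in>F. \<forall>c\<in>C. \<forall>d\<in>C. f \<otimes> c = h \<otimes> d \<longrightarrow> c = d)"
proof -
  define P where "P x y \<longleftrightarrow> x \<in> carrier G \<and> y \<in> carrier G \<and> (\<exists>f\<in>F. \<exists>h\<in>F. f \<otimes> x = h \<otimes> y)" for x y
  \<comment> \<open>The coset \<open>K\<close> is left out because its representative is to be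
    \<open>\<one>\<close>; the other representatives must then avoid conflict with
    \<open>\<one>\<close> as well.\<close>
  define \<Q> where "\<Q> = {Q \<in> lcosets K. Q \<subseteq> H} - {K}"
  have finP: "finite {y. P x y}" for x
  proof (rule finite_subset)
    show "{y. P x y} \<subseteq> (\<lambda>(f, h). inv h \<otimes> (f \<otimes> x)) ` (F \<times> F)"
    proof
      fix y assume "y \<in> {y. P x y}"
      then obtain f h where fh: "f \<in> F" "h \<in> F" "f \<otimes> x = h \<otimes> y" "x \<in> carrier G" "y \<in> carrier G"
        by (auto simp: P_def)
      then have "y = inv h \<otimes> (f \<otimes> x)"
        using F by (simp add: m_assoc[symmetric] subset_iff)
      then have "y = (\<lambda>(f, h). inv h \<otimes> (f \<otimes> x)) (f, h)"
        by (simp only: prod.case)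
      then show "y \<in> (\<lambda>(f, h). inv h \<otimes> (f \<otimes> x)) ` (F \<times> F)"
        by (rule image_eqI) (use fh in blast)
    qed
  qed (use F in auto)
  have symP: "P y x" if "P x y" for x y
    using that unfolding P_def by metis
  have fin\<Q>: "finite \<Q>"
    using K(3) by (auto simp: \<Q>_def)
  have inf\<Q>: "infinite Q" if "Q \<in> \<Q>" for Q
    using that infinite_finite_index[OF K(1,3) inf] by (auto simp: \<Q>_def)
  have "\<exists>r. (\<forall>Q\<in>\<Q>. r Q \<in> Q - {y. P \<one> y}) \<and>
      (\<forall>Q\<in>\<Q>. \<forall>R\<in>\<Q>. Q \<noteq> R \<longrightarrow> \<not> P (r Q) (r R))"
    by (rule finite_choice_avoiding[OF fin\<Q> inf\<Q> finP finP symP])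
  then obtain r where r_all: "\<forall>Q\<in>\<Q>. r Q \<in> Q - {y. P \<one> y}"
      "\<forall>Q\<in>\<Q>. \<forall>R\<in>\<Q>. Q \<noteq> R \<longrightarrow> \<not> P (r Q) (r R)"
    by (elim exE conjE)
  have r: "r Q \<in> Q" "\<not> P \<one> (r Q)" if "Q \<in> \<Q>" for Q
    using bspec[OF r_all(1) that] by simp_all
  have r_sep: "\<not> P (r Q) (r R)" if "Q \<in> \<Q>" "R \<in> \<Q>" "Q \<noteq> R" for Q R
    using r_all(2) that by blast
  define C where "C = insert \<one> (r ` \<Q>)"
  have car: "h \<in> carrier G" if "h \<in> H" for h
    using subgroup.mem_carrier[OF H that] .
  have rQ: "r Q \<in> H" "r Q \<in> carrier G" "Q = r Q <# K" if "Q \<in> \<Q>" for Q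
    using r(1)[OF that] that car lcoset_rep(2)[OF K(1)] by (auto simp: \<Q>_def)
  have one_K: "\<one> <# K = K"
    using lcos_mult_one subgroup.subset[OF K(1)] by simp
  have CH: "C \<subseteq> H"
    using rQ subgroup.one_closed[OF H] by (auto simp: C_def)
  have exh: "\<exists>c\<in>C. inv c \<otimes> h \<in> K" if h: "h \<in> H" for h
  proof (cases "h <# K = K")
    case True
    then have "inv \<one> \<otimes> h \<in> K"
      using lcos_self[OF car[OF h] K(1)] car[OF h] by simp
    then show ?thesis
      unfolding C_def by blast
  next
    case False
    have "h <# K \<subseteq> H"
      using K(2) h subgroup.m_closed[OF H] by (auto simp: l_coset_def)
    then have Q: "h <# K \<in> \<Q>"
      using False car[OF h] by (auto simp: \<Q>_def LCOSETS_def)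
    then have "inv (r (h <# K)) \<otimes> h \<in> K"
      using lcoset_rep(3)[OF K(1) _ r(1)[OF Q], of h] lcos_self[OF car[OF h] K(1)] by (auto simp: \<Q>_def)
    then show ?thesis
      using Q unfolding C_def by blast
  qed
  have sep: "c = d" if cd: "c \<in> C" "d \<in> C" "inv c \<otimes> d \<in> K" for c d
  proof -
    have cdc: "c \<in> carrier G" "d \<in> carrier G"
      using cd CH car by auto
    have eq: "c <# K = d <# K"
      using subgroup.lcos_module_rev[OF K(1) is_group cdc cd(3)] cdc(1) K(1) by (rule l_repr_independence)
    \<comment> \<open>A member of \<open>C\<close> can be read off from its coset, so equal cosets
      have equal representatives.\<close>
    have rep: "c = (if c <# K = K then \<one> else r (c <# K))" if c: "c \<in> C" for c
    proof (cases "c = \<one>")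
      case False
      then obtain Q where Q: "Q \<in> \<Q>" "c = r Q"
        using c by (auto simp: C_def)
      moreover have "Q \<noteq> K"
        using Q(1) by (simp add: \<Q>_def)
      ultimately show ?thesis
        using rQ(3)[OF Q(1), symmetric] by simp
    qed (simp add: one_K)
    show ?thesis
      using rep[OF cd(1)] rep[OF cd(2)] eq by metis
  qed
  have uniq: "c = d" if "f \<in> F" "h \<in> F" "c \<in> C" "d \<in> C" "f \<otimes> c = h \<otimes> d" for f h c d
  proof -
    \<comment> \<open>Distinct members of \<open>C\<close> are never in conflict: pairs with
      \<open>\<one>\<close> were avoided by the excluded set, other pairs by the choice of
      \<open>r\<close>.\<close>
    have "P c d"
      unfolding P_def using that CH car by blast
    moreover from this have "P d c"
      by (rule symP)
    ultimately show ?thesis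
      using that(3,4) r(2) r_sep unfolding C_def by blast
  qed
  obtain h where h: "h \<in> H" "h \<notin> K"
    using K(2) by blast
  obtain c where c: "c \<in> C" "inv c \<otimes> h \<in> K"
    using exh[OF h(1)] by blast
  then have "c \<noteq> \<one>"
    using h car by auto
  then have "finite C" "\<one> \<in> C" "\<exists>c\<in>C. c \<noteq> \<one>"
    using c(1) fin\<Q> by (auto simp: C_def)
  then show ?thesis
    using CH exh sep uniq by (intro exI[of _ C]) blast
qed

text \<open>\<open>C n\<close> depends on \<open>F n\<close>, and \<open>F (Suc n)\<close> on both.
  With \<open>C n\<close> given by a choice function of \<open>n\<close> and \<open>F n\<close>, the
  recursion runs over \<open>F\<close> alone.\<close>

lemma (in group) odometer_tower_exists:
  assumes "countable (carrier G)" "infinite (carrier G)" "odometer_sequence G \<Gamma>"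
  shows "\<exists>F C. odometer_tower G \<Gamma> F C"
proof -
  have \<Gamma>: "subgroup (\<Gamma> n) G" "finite (lcosets (\<Gamma> n))" "\<Gamma> (Suc n) \<subset> \<Gamma> n" for n
    using assms(3) by (auto simp: odometer_sequence_def)
  define good where "good n F C \<longleftrightarrow>
    finite C \<and> C \<subseteq> \<Gamma> n \<and> \<one> \<in> C \<and> (\<exists>c\<in>C. c \<noteq> \<one>) \<and> (\<forall>h\<in>\<Gamma> n. \<exists>c\<in>C. inv c \<otimes> h \<in> \<Gamma> (Suc n)) \<and>
    (\<forall>c\<in>C. \<forall>d\<in>C. inv c \<otimes> d \<in> \<Gamma> (Suc n) \<longrightarrow> c = d) \<and>
    (\<forall>f\<in>F. \<forall>h\<in>F. \<forall>c\<in>C. \<forall>d\<in>C. f \<otimes> c = h \<otimes> d \<longrightarrow> c = d)" for n F C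
  define c where "c n F = (SOME C. good n F C)" for n F
  have c: "good n F (c n F)" if "finite F" "F \<subseteq> carrier G" for n F
    unfolding c_def
  proof (rule someI_ex)
    show "\<exists>C. good n F C"
      unfolding good_def using separated_transversal[OF \<Gamma>(1) \<Gamma>(1) \<Gamma>(3) \<Gamma>(2) assms(2) that] .
  qed
  \<comment> \<open>The first \<open>n + 1\<close> members of an enumeration of the group, so each
    \<open>g\<close> belongs to \<open>K n\<close> from its index on. The identity is added so that
    \<open>F n C n\<close> is contained in \<open>F (Suc n)\<close>.\<close>
  define K where "K n = insert \<one> (from_nat_into (carrier G) ` {..n})" for n :: nat
  have K: "finite (K n)" "K n \<subseteq> carrier G" "\<one> \<in> K n" for n
    using from_nat_into[of "carrier G"] one_closed by (auto simp: K_def)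
  define F where "F = rec_nat {\<one>} (\<lambda>n A. (\<lambda>(k, f, d). k \<otimes> (f \<otimes> d)) ` (K n \<times> A \<times> c n A))"
  have F_0: "F 0 = {\<one>}" and F_Suc: "F (Suc n) = (\<lambda>(k, f, d). k \<otimes> (f \<otimes> d)) ` (K n \<times> F n \<times> c n (F n))" for n
    by (simp_all add: F_def)
  have F: "finite (F n) \<and> F n \<subseteq> carrier G" for n
  proof (induction n)
    case (Suc n)
    then have "finite (c n (F n))" "c n (F n) \<subseteq> carrier G"
      using c[of "F n" n] subgroup.subset[OF \<Gamma>(1)] unfolding good_def by blast+
    then show ?case
      using Suc K[of n] unfolding F_Suc by (auto simp: subset_iff)
  qed (simp add: F_0)
  define C where "C n = c n (F n)" for n
  have C: "good n (F n) (C n)" for n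
    using c F unfolding C_def by blast
  have C_carrier: "C n \<subseteq> carrier G" for n
    using C subgroup.subset[OF \<Gamma>(1)] unfolding good_def by blast
  have F_in: "k \<otimes> (f \<otimes> d) \<in> F (Suc n)" if "k \<in> K n" "f \<in> F n" "d \<in> C n" for k f d n
    using that unfolding F_Suc C_def by force
  have "odometer_tower G \<Gamma> F C"
  proof (intro odometer_tower.intro odometer_tower_axioms.intro is_group)
    show "F 0 = {\<one>}"
      by (rule F_0)
  next
    fix n
    show "subgroup (\<Gamma> n) G" "\<Gamma> (Suc n) \<subseteq> \<Gamma> n" "finite (F n)" "F n \<subseteq> carrier G"
      using \<Gamma> F by auto
    show "C n \<subseteq> \<Gamma> n" "\<one> \<in> C n" "\<exists>c\<in>C n. c \<noteq> \<one>"
      using C unfolding good_def by blast+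
    show "\<exists>c\<in>C n. inv c \<otimes> h \<in> \<Gamma> (Suc n)" if "h \<in> \<Gamma> n" for h
      using C that unfolding good_def by blast
    show "c = d" if "c \<in> C n" "d \<in> C n" "inv c \<otimes> d \<in> \<Gamma> (Suc n)" for c d
      using C that unfolding good_def by blast
    show "c = d" if "f \<in> F n" "h \<in> F n" "c \<in> C n" "d \<in> C n" "f \<otimes> c = h \<otimes> d" for f h c d
      using C that unfolding good_def by blast
    show "f \<otimes> d \<in> F (Suc n)" if "f \<in> F n" "d \<in> C n" for f d
    proof -
      have "f \<in> carrier G" "d \<in> carrier G"
        using that F C_carrier by blast+
      then show ?thesis
        using F_in[OF K(3) that] by simp
    qed
  next
    fix g assume g: "g \<in> carrier G"
    obtain N where N: "from_nat_into (carrier G) N = g"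
      using from_nat_into_surj[OF assms(1) g] by blast
    have "g \<in> K n" if "N \<le> n" for n
      using N that unfolding K_def by blast
    then show "\<exists>N. \<forall>n\<ge>N. \<forall>f\<in>F n. \<forall>c\<in>C n. g \<otimes> (f \<otimes> c) \<in> F (Suc n)"
      using F_in by (intro exI[of _ N]) simp
  qed
  then show ?thesis
    by blast
qed

theorem theoremD:
  fixes G :: "('a, 'b) monoid_scheme"
    and \<Gamma> :: "nat \<Rightarrow> 'a set"
    and haar :: "(nat \<Rightarrow> 'a set) measure"
  assumes "group G"
    and "countable (carrier G)"
    and "infinite (carrier G)"
    and "residually_finite G"
    and "odometer_sequence G \<Gamma>"
    and "odometer_Haar_measure G \<Gamma> haar"
  shows "\<exists>(X :: (nat \<Rightarrow> 'a set) topology) (\<mu> :: (nat \<Rightarrow> 'a set) measure) T \<pi>.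
           locally_compact_Cantor_space X \<and>
           sets \<mu> = sets (borel_of X) \<and> sigma_finite_measure \<mu> \<and>
           continuous_action G X T \<and>
           measure_preserving_action G \<mu> T \<and>
           rank_one_action G \<mu> T \<and>
           continuous_map X (odometer_space G \<Gamma>) \<pi> \<and>
           (\<forall>g\<in>carrier G. \<forall>x\<in>topspace X. \<pi> (T g x) = odometer G \<Gamma> g (\<pi> x)) \<and>
           factor_map G \<mu> T haar (odometer G \<Gamma>) \<pi> \<and>
           equivalent_measures (distr \<mu> haar \<pi>) haar"
proof -
  obtain F C where "odometer_tower G \<Gamma> F C"
    using group.odometer_tower_exists[OF assms(1,2,3,5)] by blast
  then interpret odometer_tower G \<Gamma> F C .
  interpret odometer_tower_Haar G \<Gamma> F C haar
    by unfold_locales (fact assms)+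
  have "continuous_action G pts_top act"
    using act_group_action act_continuous by (simp add: continuous_action_def topspace_pts_top)
  moreover have "\<forall>g\<in>carrier G. \<forall>x\<in>topspace pts_top. proj (act g x) = odometer G \<Gamma> g (proj x)"
    using proj_act by (simp add: topspace_pts_top)
  ultimately show ?thesis
    using pts_top_Cantor sets_\<mu> sigma_finite_\<mu> act_measure_preserving act_rank_one
      proj_continuous proj_factor proj_equivalent
    by (intro exI conjI)
qed

end
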